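(* Let $p,q,r$ be distinct primes. Then the group $\overline{K}\cong C_p * C_q * C_r$ presented by $K=\langle x,y,z \mid x^p, y^q, z^r\rangle$ is finitely annihilated, but its abelianisation $\overline{K}^{\mathrm{ab}}\cong C_{pqr}$ is cyclic.
   Context: $C_m$ denotes the cyclic group of order $m$, and $*$ the free product. For a presentation $K$, $\overline{K}$ denotes the group it presents. An element $g$ of a group $G$ is finitely annihilated if there is a finite group $H_g$ and a homomorphism $\phi_g: G\to H_g$ with $\phi_g(g)=e$ and $\mathrm{Im}(\phi_g)\neq\{e\}$. A non-trivial group $G$ is finitely annihilated (F-A) if all its non-trivial elements are finitely annihilated; equivalently, $G$ is the union of all its proper, normal, finite index subgroups. The trivial group is by convention not F-A. *)

theory Defs
  imports
    "HOL-Algebra.Elementary_Groups"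
    "HOL-Computational_Algebra.Primes"
begin

section \<open>Words modulo a congruence\<close>

definition word_quotient :: "'l list set \<Rightarrow> ('l list \<times> 'l list) set \<Rightarrow> 'l list set monoid"
  where "word_quotient W E =
    \<lparr>carrier = W // E,
     monoid.mult = (\<lambda>A B. \<Union>a\<in>A. \<Union>b\<in>B. E `` {a @ b}),
     one = E `` {[]}\<rparr>"

locale word_congruence =
  fixes W :: "'l list set" and E :: "('l list \<times> 'l list) set"
  assumes equiv: "equiv W E"
    and nil: "[] \<in> W"
    and append: "\<lbrakk>u \<in> W; v \<in> W\<rbrakk> \<Longrightarrow> u @ v \<in> W"
    and cong: "\<lbrakk>(u, u') \<in> E; (v, v') \<in> E\<rbrakk> \<Longrightarrow> (u @ v, u' @ v') \<in> E"
begin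

lemma mult_class:
  assumes "u \<in> W" "v \<in> W"
  shows "E `` {u} \<otimes>\<^bsub>word_quotient W E\<^esub> E `` {v} = E `` {u @ v}"
proof -
  have *: "E `` {a @ b} = E `` {u @ v}" if "a \<in> E `` {u}" "b \<in> E `` {v}" for a b
  proof -
    have "(u @ v, a @ b) \<in> E" using that by (intro cong) auto
    then show ?thesis by (rule equiv_class_eq[OF equiv, symmetric])
  qed
  have "u \<in> E `` {u}" "v \<in> E `` {v}"
    using assms by (simp_all only: equiv_class_self[OF equiv])
  then have "(\<Union>a\<in>E `` {u}. \<Union>b\<in>E `` {v}. E `` {a @ b}) =
      (\<Union>a\<in>E `` {u}. \<Union>b\<in>E `` {v}. E `` {u @ v})"
    using * by (intro SUP_cong refl)
  also have "\<dots> = E `` {u @ v}"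
    using \<open>u \<in> E `` {u}\<close> \<open>v \<in> E `` {v}\<close> by blast
  finally show ?thesis
    by (simp add: word_quotient_def)
qed

lemma group_word_quotient:
  assumes inv: "\<And>u. u \<in> W \<Longrightarrow> \<exists>v\<in>W. (v @ u, []) \<in> E"
  shows "group (word_quotient W E)"
proof (rule groupI)
  let ?G = "word_quotient W E"
  have car: "x \<in> carrier ?G \<longleftrightarrow> (\<exists>u\<in>W. x = E `` {u})" for x
    by (auto simp: word_quotient_def quotient_def)
  have one: "\<one>\<^bsub>?G\<^esub> = E `` {[]}"
    by (simp add: word_quotient_def)
  show "\<one>\<^bsub>?G\<^esub> \<in> carrier ?G"
    using one car nil by auto
  fix x assume "x \<in> carrier ?G"
  then obtain u where u: "u \<in> W" "x = E `` {u}" using car by auto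
  show "\<one>\<^bsub>?G\<^esub> \<otimes>\<^bsub>?G\<^esub> x = x"
    using u one mult_class[OF nil u(1)] by simp
  obtain v where v: "v \<in> W" "(v @ u, []) \<in> E" using inv u by blast
  have "E `` {v} \<otimes>\<^bsub>?G\<^esub> x = \<one>\<^bsub>?G\<^esub>"
    using u v(1) one mult_class equiv_class_eq[OF equiv v(2)] by simp
  then show "\<exists>y\<in>carrier ?G. y \<otimes>\<^bsub>?G\<^esub> x = \<one>\<^bsub>?G\<^esub>"
    using car v by blast
  fix y assume "y \<in> carrier ?G"
  then obtain v where v: "v \<in> W" "y = E `` {v}" using car by auto
  show "x \<otimes>\<^bsub>?G\<^esub> y \<in> carrier ?G"
    using u v mult_class append car by auto
  fix z assume "z \<in> carrier ?G"
  then obtain w where w: "w \<in> W" "z = E `` {w}" using car by auto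
  show "x \<otimes>\<^bsub>?G\<^esub> y \<otimes>\<^bsub>?G\<^esub> z = x \<otimes>\<^bsub>?G\<^esub> (y \<otimes>\<^bsub>?G\<^esub> z)"
    using u v w mult_class append by simp
qed

end


section \<open>Free groups and presentations\<close>

text \<open>The free generators are all elements of the type; the letter \<open>(x, True)\<close> stands
  for the generator \<open>x\<close> and \<open>(x, False)\<close> for its inverse.\<close>

inductive free_eq :: "('x \<times> bool) list \<Rightarrow> ('x \<times> bool) list \<Rightarrow> bool" where
  refl: "free_eq u u"
| sym: "free_eq u v \<Longrightarrow> free_eq v u"
| trans: "\<lbrakk>free_eq u v; free_eq v w\<rbrakk> \<Longrightarrow> free_eq u w"
| cancel: "free_eq (u @ [(x, b), (x, \<not> b)] @ v) (u @ v)"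

definition free_group :: "('x \<times> bool) list set monoid"
  where "free_group = word_quotient UNIV {(u, v). free_eq u v}"

definition free_gen :: "'x \<Rightarrow> ('x \<times> bool) list set"
  where "free_gen x = {(u, v). free_eq u v} `` {[(x, True)]}"

definition normal_closure :: "('a, 'b) monoid_scheme \<Rightarrow> 'a set \<Rightarrow> 'a set"
  where "normal_closure G S = \<Inter> {N. N \<lhd> G \<and> S \<subseteq> N}"

definition presented_group ::
    "('x \<times> bool) list set set \<Rightarrow> ('x \<times> bool) list set set monoid"
  where "presented_group R = free_group Mod normal_closure free_group R"

lemma free_eq_context: "free_eq u v \<Longrightarrow> free_eq (s @ u @ t) (s @ v @ t)"
proof (induction rule: free_eq.induct)
  case (refl u)
  show ?case by (rule free_eq.refl)
next
  case (sym u v)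
  then show ?case by (rule_tac free_eq.sym)
next
  case (trans u v w)
  then show ?case by (rule_tac free_eq.trans)
next
  case (cancel u x b v)
  show ?case using free_eq.cancel[of "s @ u" x b "v @ t"] by simp
qed

lemma word_congruence_free: "word_congruence UNIV {(u, v). free_eq u v}"
proof
  show "equiv UNIV {(u, v). free_eq u v}"
    by (intro equivI refl_onI symI transI)
      (auto intro: free_eq.refl elim: free_eq.sym free_eq.trans)
  fix u u' v v' :: "('a \<times> bool) list"
  assume "(u, u') \<in> {(u, v). free_eq u v}" "(v, v') \<in> {(u, v). free_eq u v}"
  then show "(u @ v, u' @ v') \<in> {(u, v). free_eq u v}"
    using free_eq_context[of u u' "[]" v] free_eq_context[of v v' u' "[]"]
    using free_eq.trans by fastforce
qed auto

lemma group_free_group: "group (free_group :: ('x \<times> bool) list set monoid)"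
proof -
  interpret word_congruence UNIV "{(u, v). free_eq u v} :: (('x \<times> bool) list \<times> _) set"
    by (rule word_congruence_free)
  have "\<exists>v. free_eq (v @ u) []" for u :: "('x \<times> bool) list"
  proof (induction u)
    case (Cons a u)
    then obtain v where v: "free_eq (v @ u) []" by blast
    obtain x b where a: "a = (x, b)" by force
    have "free_eq ((v @ [(x, \<not> b)]) @ a # u) (v @ u)"
      using free_eq.cancel[of v x "\<not> b" u] a by simp
    then show ?case using v free_eq.trans by blast
  qed (auto intro: free_eq.refl)
  then show ?thesis
    unfolding free_group_def by (intro group_word_quotient) auto
qed

lemma (in group) normal_closure_normal:
  assumes "S \<subseteq> carrier G" shows "normal_closure G S \<lhd> G"
proof -
  have G: "carrier G \<lhd> G"
    by (simp add: normal_inv_iff subgroup_self)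
  have ne: "{N. N \<lhd> G \<and> S \<subseteq> N} \<noteq> {}"
    using G assms by blast
  have "subgroup (normal_closure G S) G"
    unfolding normal_closure_def
    by (rule subgroups_Inter[OF _ ne]) (auto simp: normal_imp_subgroup)
  moreover have "x \<otimes> h \<otimes> inv x \<in> normal_closure G S"
    if "x \<in> carrier G" "h \<in> normal_closure G S" for x h
    using that unfolding normal_closure_def by (auto simp: normal_inv_iff)
  ultimately show ?thesis
    by (simp add: normal_inv_iff)
qed

lemma free_gen_carrier: "free_gen x \<in> carrier free_group"
  by (simp add: free_gen_def free_group_def word_quotient_def quotient_def) blast

lemma group_presented_group:
  "R \<subseteq> carrier free_group \<Longrightarrow> group (presented_group R)"
  unfolding presented_group_def
  by (intro normal.factorgroup_is_group group.normal_closure_normal group_free_group)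


section \<open>Free products\<close>

inductive free_product_eq ::
    "'i set \<Rightarrow> ('i \<Rightarrow> ('a, 'b) monoid_scheme) \<Rightarrow> ('i \<times> 'a) list \<Rightarrow> ('i \<times> 'a) list \<Rightarrow> bool"
  for I G where
  refl: "u \<in> lists (SIGMA i:I. carrier (G i)) \<Longrightarrow> free_product_eq I G u u"
| sym: "free_product_eq I G u v \<Longrightarrow> free_product_eq I G v u"
| trans: "\<lbrakk>free_product_eq I G u v; free_product_eq I G v w\<rbrakk> \<Longrightarrow> free_product_eq I G u w"
| unit: "\<lbrakk>u \<in> lists (SIGMA i:I. carrier (G i)); v \<in> lists (SIGMA i:I. carrier (G i)); i \<in> I\<rbrakk>
    \<Longrightarrow> free_product_eq I G (u @ [(i, \<one>\<^bsub>G i\<^esub>)] @ v) (u @ v)"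
| merge: "\<lbrakk>u \<in> lists (SIGMA i:I. carrier (G i)); v \<in> lists (SIGMA i:I. carrier (G i)); i \<in> I;
      a \<in> carrier (G i); b \<in> carrier (G i)\<rbrakk>
    \<Longrightarrow> free_product_eq I G (u @ [(i, a), (i, b)] @ v) (u @ [(i, a \<otimes>\<^bsub>G i\<^esub> b)] @ v)"

definition free_product ::
    "'i set \<Rightarrow> ('i \<Rightarrow> ('a, 'b) monoid_scheme) \<Rightarrow> ('i \<times> 'a) list set monoid"
  where "free_product I G =
    word_quotient (lists (SIGMA i:I. carrier (G i))) {(u, v). free_product_eq I G u v}"

lemma free_product_eq_context:
  assumes "free_product_eq I G u v"
    and "s \<in> lists (SIGMA i:I. carrier (G i))" "t \<in> lists (SIGMA i:I. carrier (G i))"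
  shows "free_product_eq I G (s @ u @ t) (s @ v @ t)"
  using assms
proof (induction rule: free_product_eq.induct)
  case (refl u)
  then show ?case by (intro free_product_eq.refl) auto
next
  case (unit u v i)
  then show ?case using free_product_eq.unit[of "s @ u" I G "v @ t" i] by simp
next
  case (merge u v i a b)
  then show ?case using free_product_eq.merge[of "s @ u" I G "v @ t" i a b] by simp
next
  case (sym u v)
  then show ?case by (metis free_product_eq.sym)
next
  case (trans u v w)
  then show ?case by (metis free_product_eq.trans)
qed

lemma group_free_product:
  assumes grp: "\<And>i. i \<in> I \<Longrightarrow> group (G i)"
  shows "group (free_product I G)"
proof -
  let ?W = "lists (SIGMA i:I. carrier (G i))" and ?E = "{(u, v). free_product_eq I G u v}"
  have W: "u \<in> ?W \<and> v \<in> ?W" if "free_product_eq I G u v" for u v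
    using that
  proof (induction rule: free_product_eq.induct)
    case (unit u v i)
    then show ?case using group.is_monoid[OF grp[of i]] by auto
  next
    case (merge u v i a b)
    then show ?case using monoid.m_closed[OF group.is_monoid[OF grp[of i]]] by auto
  qed auto
  interpret word_congruence ?W ?E
  proof
    show "equiv ?W ?E"
    proof (intro equivI refl_onI symI transI)
      show "?E \<subseteq> ?W \<times> ?W" using W by blast
    qed (auto intro: free_product_eq.refl elim: free_product_eq.sym free_product_eq.trans)
    fix u u' v v'
    assume *: "(u, u') \<in> ?E" "(v, v') \<in> ?E"
    then have "free_product_eq I G (u @ v) (u' @ v)" "free_product_eq I G (u' @ v) (u' @ v')"
      using W free_product_eq_context[of I G u u' "[]" v]
        free_product_eq_context[of I G v v' u' "[]"] by auto
    then show "(u @ v, u' @ v') \<in> ?E"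
      using free_product_eq.trans by fastforce
  qed auto
  have "\<exists>v\<in>?W. free_product_eq I G (v @ u) []" if "u \<in> ?W" for u
    using that
  proof (induction rule: lists.induct)
    case Nil
    then show ?case by (auto intro: free_product_eq.refl bexI[of _ "[]"])
  next
    case (Cons l u)
    then obtain v where v: "v \<in> ?W" "free_product_eq I G (v @ u) []" by auto
    obtain i a where l: "l = (i, a)" "i \<in> I" "a \<in> carrier (G i)" and u: "u \<in> ?W"
      using Cons.hyps by auto
    interpret Gi: group "G i" using grp l by simp
    have x: "free_product_eq I G ((v @ [(i, inv\<^bsub>G i\<^esub> a)]) @ l # u) (v @ [(i, \<one>\<^bsub>G i\<^esub>)] @ u)"
      using free_product_eq.merge[OF v(1) u l(2), of "inv\<^bsub>G i\<^esub> a" a] l by simp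
    have "free_product_eq I G (v @ [(i, \<one>\<^bsub>G i\<^esub>)] @ u) (v @ u)"
      using free_product_eq.unit[OF v(1) u l(2)] .
    then have "free_product_eq I G ((v @ [(i, inv\<^bsub>G i\<^esub> a)]) @ l # u) []"
      using x v(2) free_product_eq.trans by metis
    moreover have "v @ [(i, inv\<^bsub>G i\<^esub> a)] \<in> ?W"
      using v l by auto
    ultimately show ?case by blast
  qed
  then show ?thesis
    unfolding free_product_def by (intro group_word_quotient) auto
qed


section \<open>Finitely annihilated groups and abelianisations\<close>

text \<open>One cannot quantify over types inside a formula, so the finite target group is taken with
  its carrier in \<open>nat\<close>. This is no restriction, see \<open>finitely_annihilated_elementI\<close> below.\<close>

definition finitely_annihilated_element :: "('a, 'b) monoid_scheme \<Rightarrow> 'a \<Rightarrow> bool"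
  where "finitely_annihilated_element G g \<longleftrightarrow>
    (\<exists>(H :: nat monoid) \<phi>. group H \<and> finite (carrier H) \<and> \<phi> \<in> hom G H \<and>
      \<phi> g = \<one>\<^bsub>H\<^esub> \<and> \<phi> ` carrier G \<noteq> {\<one>\<^bsub>H\<^esub>})"

definition finitely_annihilated :: "('a, 'b) monoid_scheme \<Rightarrow> bool"
  where "finitely_annihilated G \<longleftrightarrow>
    carrier G \<noteq> {\<one>\<^bsub>G\<^esub>} \<and>
    (\<forall>g \<in> carrier G. g \<noteq> \<one>\<^bsub>G\<^esub> \<longrightarrow> finitely_annihilated_element G g)"

lemma finitely_annihilated_elementI:
  fixes G :: "('a, 'b) monoid_scheme" and H :: "('c, 'd) monoid_scheme"
  assumes "group G" "group H" "finite (carrier H)" "\<phi> \<in> hom G H" "g \<in> carrier G"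
    and "\<phi> g = \<one>\<^bsub>H\<^esub>" "\<phi> ` carrier G \<noteq> {\<one>\<^bsub>H\<^esub>}"
  shows "finitely_annihilated_element G g"
proof -
  interpret H: group H by fact
  obtain f :: "'c \<Rightarrow> nat" where f: "inj_on f (carrier H)"
    using finite_imp_inj_to_nat_seg[OF assms(3)] by blast
  define h where "h = inv_into (carrier H) f"
  have h: "h (f x) = x" if "x \<in> carrier H" for x
    using f that by (simp add: h_def)
  define H' :: "nat monoid" where
    "H' = \<lparr>carrier = f ` carrier H, monoid.mult = (\<lambda>m n. f (h m \<otimes>\<^bsub>H\<^esub> h n)), one = f \<one>\<^bsub>H\<^esub>\<rparr>"
  have "group H'"
  proof (rule groupI)
    fix x assume "x \<in> carrier H'"
    then obtain a where "a \<in> carrier H" "x = f a" by (auto simp: H'_def)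
    then show "\<exists>y\<in>carrier H'. y \<otimes>\<^bsub>H'\<^esub> x = \<one>\<^bsub>H'\<^esub>"
      by (intro bexI[of _ "f (inv\<^bsub>H\<^esub> a)"]) (auto simp: H'_def h)
  qed (auto simp: H'_def h H.m_assoc)
  moreover have "f \<circ> \<phi> \<in> hom G H'"
    using assms(4) by (auto simp: hom_def H'_def h Pi_iff)
  moreover have "(f \<circ> \<phi>) ` carrier G \<noteq> {\<one>\<^bsub>H'\<^esub>}"
  proof
    assume *: "(f \<circ> \<phi>) ` carrier G = {\<one>\<^bsub>H'\<^esub>}"
    have "\<phi> x = \<one>\<^bsub>H\<^esub>" if "x \<in> carrier G" for x
    proof -
      have "f (\<phi> x) = f \<one>\<^bsub>H\<^esub>" using * that by (auto simp: H'_def)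
      moreover have "\<phi> x \<in> carrier H" using assms(4) that by (auto simp: hom_def)
      ultimately show ?thesis using f by (simp add: inj_on_eq_iff)
    qed
    then show False using assms(5,7) by auto
  qed
  ultimately show ?thesis
    unfolding finitely_annihilated_element_def using assms(3,6)
    by (intro exI[of _ H'] exI[of _ "f \<circ> \<phi>"]) (auto simp: H'_def)
qed


definition abelianisation :: "('a, 'b) monoid_scheme \<Rightarrow> 'a set monoid"
  where "abelianisation G = G Mod derived G (carrier G)"


section \<open>The presentation with three generators\<close>

datatype xyz = Gen_x | Gen_y | Gen_z

definition group_K :: "nat \<Rightarrow> nat \<Rightarrow> nat \<Rightarrow> (xyz \<times> bool) list set set monoid"
  where "group_K p q r = presented_group
    {free_gen Gen_x [^]\<^bsub>free_group\<^esub> p,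
     free_gen Gen_y [^]\<^bsub>free_group\<^esub> q,
     free_gen Gen_z [^]\<^bsub>free_group\<^esub> r}"

lemma group_group_K: "group (group_K p q r)"
  unfolding group_K_def
  by (intro group_presented_group)
    (auto intro!: monoid.nat_pow_closed group.is_monoid group_free_group free_gen_carrier)

end

theory Submission
  imports Defs "HOL-Homology.Homology" "HOL-Analysis.Analysis" "HOL-Number_Theory.Cong"
begin

hide_const (open) up_ring.coeff up_ring.monom module.smult

text \<open>
  The isomorphism with the free product comes from comparing universal properties: each of the
  two groups maps to the other, and the composites fix generators. The abelianisation is
  \<open>C\<^bsub>pqr\<^esub>\<close> because the homomorphism sending \<open>x, y, z\<close> to \<open>qr, pr, pq\<close> is onto,
  and an element of its kernel has exponent sums divisible by \<open>p, q, r\<close>, so it is trivial in every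
  abelian quotient.

  The substance is finite annihilation. It says that no element \<open>u\<close> normally generates the group,
  which is the Scott--Wiegold conjecture, together with a finite witness. If the exponent sum of some
  generator in \<open>u\<close> is divisible by the order of that generator, then \<open>u\<close> dies in a cyclic
  quotient (\<open>finitely_annihilated_exponent_sum\<close>). Otherwise the argument is Howie's. Let
  \<open>x, y, z\<close> act as rotations of 3-space by fixed angles, so that the orders are right, but
  about variable axes: \<open>x\<close> about a fixed axis, \<open>y\<close> about one at angle \<open>\<theta>\<close> from it, and
  \<open>z\<close> about any \<open>v\<close> on the 2-sphere. Lifted to unit quaternions, \<open>u\<close> becomes a map
  \<open>W \<theta> v\<close>. Suppose that it never takes a value \<open>\<plusminus> 1\<close>. Then its normalised imaginary part is a
  homotopy of self-maps of the sphere from \<open>\<theta> = 0\<close> to \<open>\<theta> = \<pi>\<close>. At both ends the axes of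
  \<open>x\<close> and \<open>y\<close> are parallel, so the map commutes with rotations about this common axis, and such a
  map is determined up to homotopy by its values at the two poles (\<open>axial_homotopic\<close>). At the
  poles everything commutes, and \<open>W\<close> can be computed from the exponent sums. Since the three primes
  are distinct, the angles can be chosen such that one end map fixes the poles and the other one
  exchanges them. The first is homotopic to the identity, the second to a reflection, and these have
  degrees \<open>1\<close> and \<open>- 1\<close>. Hence some choice of axes kills \<open>u\<close> up to sign
  (\<open>quaternion_solution\<close>), while \<open>x\<close> survives.

  This gives an infinite quotient. A finite one is obtained as in Malcev's theorem: the coordinates of
  the three quaternions lie in a finitely generated subring of the reals, and such a ring has finite
  quotients in which a given nonzero element stays nonzero
  (\<open>residually_finite_ring_containing\<close>). Reducing the quaternions modulo a suitable ideal, and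
  modulo sign, gives a finite group in which \<open>u\<close> is trivial and \<open>x\<close> is not
  (\<open>finitely_annihilated_of_quaternions\<close>).
\<close>

section \<open>Words and the presented group\<close>

primrec word_eval :: "('a, 'b) monoid_scheme \<Rightarrow> ('x \<Rightarrow> 'a) \<Rightarrow> ('x \<times> bool) list \<Rightarrow> 'a" where
  "word_eval H e [] = \<one>\<^bsub>H\<^esub>"
| "word_eval H e (l # u) = (if snd l then e (fst l) else inv\<^bsub>H\<^esub> e (fst l)) \<otimes>\<^bsub>H\<^esub> word_eval H e u"

definition exponent_sum :: "'x \<Rightarrow> ('x \<times> bool) list \<Rightarrow> int" where
  "exponent_sum x u = (\<Sum>l\<leftarrow>u. if fst l = x then if snd l then 1 else -1 else 0)"

lemma exponent_sum_simps [simp]: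
  "exponent_sum x [] = 0"
  "exponent_sum x (l # u) = (if fst l = x then if snd l then 1 else -1 else 0) + exponent_sum x u"
  by (simp_all add: exponent_sum_def)

lemma group_homI: "\<lbrakk>group G; group H; h \<in> hom G H\<rbrakk> \<Longrightarrow> group_hom G H h"
  by (simp add: group_hom_def group_hom_axioms_def)

context group
begin

lemma word_eval_closed [simp]: "range e \<subseteq> carrier G \<Longrightarrow> word_eval G e u \<in> carrier G"
  by (induction u) auto

lemma word_eval_append:
  "range e \<subseteq> carrier G \<Longrightarrow> word_eval G e (u @ v) = word_eval G e u \<otimes> word_eval G e v"
  by (induction u) (auto simp: m_assoc image_subset_iff)

lemma word_eval_free_eq:
  assumes e: "range e \<subseteq> carrier G"
  shows "free_eq u v \<Longrightarrow> word_eval G e u = word_eval G e v"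
proof (induction rule: free_eq.induct)
  case (cancel u x b v)
  have x: "e x \<in> carrier G" using e by auto
  have "word_eval G e ([(x, b), (x, \<not> b)] @ v) = word_eval G e v"
    using x e by (cases b) (simp_all flip: m_assoc)
  then show ?case by (simp only: word_eval_append[OF e, of u])
qed auto

end

lemma (in group_hom) hom_word_eval:
  "range e \<subseteq> carrier G \<Longrightarrow> h (word_eval G e u) = word_eval H (h \<circ> e) u"
  by (induction u) (auto simp: image_subset_iff)

text \<open>In an abelian group only the exponent sums of a word matter.\<close>

lemma (in comm_group) word_eval_xyz:
  assumes e: "range e \<subseteq> carrier G"
  shows "word_eval G e u = e Gen_x [^] exponent_sum Gen_x u \<otimes> e Gen_y [^] exponent_sum Gen_y u
     \<otimes> e Gen_z [^] exponent_sum Gen_z u"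
proof (induction u)
  case (Cons l u)
  have c: "e x \<in> carrier G" for x using e by auto
  have *: "(if b then e x else inv e x) = e x [^] (if b then 1 else -1 :: int)" for b x
    using c[of x] by (auto simp: int_pow_neg)
  obtain x b where l: "l = (x, b)" by force
  show ?case
    using c by (cases x) (simp_all add: l * Cons.IH int_pow_mult m_ac)
qed simp

definition word_class :: "('x \<times> bool) list \<Rightarrow> ('x \<times> bool) list set" where
  "word_class u = {(u, v). free_eq u v} `` {u}"

lemma word_class_eq: "word_class u = {v. free_eq u v}"
  by (auto simp: word_class_def)

lemma free_group_simps:
  "carrier free_group = range word_class"
  "\<one>\<^bsub>free_group\<^esub> = word_class []"
  "word_class u \<otimes>\<^bsub>free_group\<^esub> word_class v = word_class (u @ v)"
  "free_gen x = word_class [(x, True)]"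
  using word_congruence.mult_class[OF word_congruence_free, of u v]
  by (auto simp: free_group_def word_quotient_def word_class_def quotient_def free_gen_def)

lemma inv_free_gen: "inv\<^bsub>free_group\<^esub> free_gen x = word_class [(x, False)]"
proof -
  interpret group "free_group :: ('a \<times> bool) list set monoid" by (rule group_free_group)
  have "free_eq [(x, False), (x, True)] []"
    using free_eq.cancel[of "[]" x False "[]"] by simp
  then have "word_class [(x, False), (x, True)] = word_class []"
    unfolding word_class_eq using free_eq.sym free_eq.trans by blast
  then show ?thesis
    by (intro inv_equality) (simp_all add: free_group_simps)
qed

lemma word_eval_free_group: "word_eval free_group free_gen u = word_class u"
proof (induction u)
  case (Cons l u)
  obtain x b where "l = (x, b)" by force
  then show ?case
    by (simp only: word_eval.simps Cons.IH inv_free_gen) (simp add: free_group_simps)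
qed (simp add: free_group_simps)

text \<open>The value at a class may be read off from any representative by \<open>word_eval_free_eq\<close>, so choosing one
  gives a homomorphism.\<close>

lemma (in group) free_group_universal:
  assumes e: "range e \<subseteq> carrier G"
  shows "\<exists>\<phi>\<in>hom free_group G. \<forall>u. \<phi> (word_class u) = word_eval G e u"
proof -
  define \<phi> where "\<phi> C = word_eval G e (SOME u. u \<in> C)" for C
  have \<phi>: "\<phi> (word_class u) = word_eval G e u" for u
    unfolding \<phi>_def word_class_eq
    by (rule someI2[of _ u]) (auto intro: free_eq.refl word_eval_free_eq[OF e, symmetric])
  have "\<phi> \<in> hom free_group G"
    by (auto simp: hom_def free_group_simps \<phi> e word_eval_append[OF e])
  then show ?thesis using \<phi> by blast
qed

lemma (in normal) factor_hom:
  assumes K: "group K" and \<phi>: "\<phi> \<in> hom G K" "\<And>x. x \<in> H \<Longrightarrow> \<phi> x = \<one>\<^bsub>K\<^esub>"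
  shows "\<exists>\<psi>\<in>hom (G Mod H) K. \<forall>x\<in>carrier G. \<psi> (H #> x) = \<phi> x"
proof -
  interpret h: group_hom G K \<phi> by (rule group_homI[OF is_group K \<phi>(1)])
  define \<psi> where "\<psi> C = \<phi> (SOME x. x \<in> C)" for C
  have \<psi>: "\<psi> (H #> x) = \<phi> x" if x: "x \<in> carrier G" for x
  proof -
    have "\<phi> y = \<phi> x" if "y \<in> H #> x" for y
      using that x \<phi>(2) mem_carrier by (auto simp: r_coset_def)
    then show ?thesis unfolding \<psi>_def
      using rcos_self[OF x is_subgroup] by (metis someI)
  qed
  have "\<psi> \<in> hom (G Mod H) K"
    using \<psi> by (auto simp: hom_def FactGroup_def RCOSETS_def rcos_sum)
  then show ?thesis using \<psi> by blast
qed

definition presented_class :: "('x \<times> bool) list set set \<Rightarrow> ('x \<times> bool) list \<Rightarrow> ('x \<times> bool) list set set" where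
  "presented_class R u = normal_closure free_group R #>\<^bsub>free_group\<^esub> word_class u"

lemma carrier_presented_group: "carrier (presented_group R) = range (presented_class R)"
  by (auto simp: presented_group_def FactGroup_def RCOSETS_def presented_class_def free_group_simps)

text \<open>The kernel of the induced map on the free group is a normal subgroup that contains the relators, hence
  it contains their normal closure.\<close>

lemma presented_group_universal:
  assumes R: "R \<subseteq> carrier free_group" and H: "group H" and e: "range e \<subseteq> carrier H"
    and rel: "\<And>u. word_class u \<in> R \<Longrightarrow> word_eval H e u = \<one>\<^bsub>H\<^esub>"
  shows "\<exists>\<phi>\<in>hom (presented_group R) H. \<forall>u. \<phi> (presented_class R u) = word_eval H e u"
proof -
  interpret F: group "free_group :: ('a \<times> bool) list set monoid" by (rule group_free_group)
  interpret H: group H by (rule H)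
  obtain \<phi> where \<phi>: "\<phi> \<in> hom free_group H" "\<And>u. \<phi> (word_class u) = word_eval H e u"
    using H.free_group_universal[OF e] by blast
  interpret h: group_hom free_group H \<phi> by (rule group_homI[OF group_free_group H \<phi>(1)])
  interpret N: normal "normal_closure free_group R" free_group by (rule F.normal_closure_normal[OF R])
  have "R \<subseteq> kernel free_group H \<phi>"
    using R rel \<phi>(2) by (auto simp: kernel_def free_group_simps)
  then have "normal_closure free_group R \<subseteq> kernel free_group H \<phi>"
    unfolding normal_closure_def using h.normal_kernel by blast
  then have "\<exists>\<psi>\<in>hom (free_group Mod normal_closure free_group R) H.
      \<forall>x\<in>carrier free_group. \<psi> (normal_closure free_group R #>\<^bsub>free_group\<^esub> x) = \<phi> x"
    by (intro N.factor_hom[OF H \<phi>(1)]) (auto simp: kernel_def)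
  then show ?thesis
    unfolding presented_group_def presented_class_def by (auto simp: \<phi>(2) free_group_simps)
qed

lemma presented_class_hom:
  assumes R: "R \<subseteq> carrier free_group"
  shows "(\<lambda>x. normal_closure free_group R #>\<^bsub>free_group\<^esub> x) \<in> hom free_group (presented_group R)"
  unfolding presented_group_def
  by (intro normal.r_coset_hom_Mod group.normal_closure_normal group_free_group R)

text \<open>Taking the group itself as target shows that it is generated by the images of the free generators.
  Together with \<open>hom_word_eval\<close> this determines a homomorphism by its values on these images.\<close>

lemma word_eval_presented_group:
  assumes R: "R \<subseteq> carrier free_group"
  shows "word_eval (presented_group R) (\<lambda>x. presented_class R [(x, True)]) u = presented_class R u"
proof -
  interpret group_hom free_group "presented_group R" "\<lambda>x. normal_closure free_group R #>\<^bsub>free_group\<^esub> x"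
    by (rule group_homI[OF group_free_group group_presented_group[OF R] presented_class_hom[OF R]])
  show ?thesis
    using hom_word_eval[of free_gen u, OF image_subsetI[OF free_gen_carrier]]
    by (simp add: word_eval_free_group image_subset_iff presented_class_def o_def flip: free_group_simps(4))
qed

lemma presented_class_relator:
  assumes R: "R \<subseteq> carrier free_group" and u: "word_class u \<in> R"
  shows "presented_class R u = \<one>\<^bsub>presented_group R\<^esub>"
proof -
  interpret F: group "free_group :: ('a \<times> bool) list set monoid" by (rule group_free_group)
  interpret N: normal "normal_closure free_group R" free_group by (rule F.normal_closure_normal[OF R])
  have "word_class u \<in> normal_closure free_group R" using u by (auto simp: normal_closure_def)
  then show ?thesis
    unfolding presented_class_def presented_group_def using N.subset
    by (simp add: FactGroup_def N.rcos_const[OF F.is_group])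
qed

abbreviation K_relators :: "nat \<Rightarrow> nat \<Rightarrow> nat \<Rightarrow> (xyz \<times> bool) list set set" where
  "K_relators p q r \<equiv> {free_gen Gen_x [^]\<^bsub>free_group\<^esub> p, free_gen Gen_y [^]\<^bsub>free_group\<^esub> q,
     free_gen Gen_z [^]\<^bsub>free_group\<^esub> r}"

lemma K_relators_carrier: "K_relators p q r \<subseteq> carrier free_group"
  by (auto intro!: monoid.nat_pow_closed group.is_monoid group_free_group free_gen_carrier)

definition K_class :: "nat \<Rightarrow> nat \<Rightarrow> nat \<Rightarrow> (xyz \<times> bool) list \<Rightarrow> (xyz \<times> bool) list set set" where
  "K_class p q r = presented_class (K_relators p q r)"

lemma carrier_group_K: "carrier (group_K p q r) = range (K_class p q r)"
  by (simp add: group_K_def K_class_def carrier_presented_group)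

abbreviation K_gen :: "nat \<Rightarrow> nat \<Rightarrow> nat \<Rightarrow> xyz \<Rightarrow> (xyz \<times> bool) list set set" where
  "K_gen p q r x \<equiv> K_class p q r [(x, True)]"

lemma word_eval_group_K: "word_eval (group_K p q r) (K_gen p q r) u = K_class p q r u"
  unfolding group_K_def K_class_def by (rule word_eval_presented_group[OF K_relators_carrier])

fun gen_order :: "nat \<Rightarrow> nat \<Rightarrow> nat \<Rightarrow> xyz \<Rightarrow> nat" where
  "gen_order p q r Gen_x = p"
| "gen_order p q r Gen_y = q"
| "gen_order p q r Gen_z = r"

lemma free_gen_pow: "free_gen x [^]\<^bsub>free_group\<^esub> (n::nat) = word_class (replicate n (x, True))"
proof (induction n)
  case 0
  then show ?case by (simp add: free_group_simps nat_pow_def)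
next
  case (Suc n)
  then show ?case by (simp add: monoid.nat_pow_Suc[OF group.is_monoid[OF group_free_group]] free_group_simps flip: replicate_append_same)
qed

lemma (in group) word_eval_replicate:
  "range e \<subseteq> carrier G \<Longrightarrow> word_eval G e (replicate n (x, True)) = e x [^] n"
  by (induction n) (auto simp: nat_pow_Suc2[symmetric] image_subset_iff simp del: nat_pow_Suc)

lemma group_K_universal:
  assumes H: "group H" and e: "range e \<subseteq> carrier H" and ord: "\<And>x. e x [^]\<^bsub>H\<^esub> gen_order p q r x = \<one>\<^bsub>H\<^esub>"
  shows "\<exists>\<phi>\<in>hom (group_K p q r) H. \<forall>u. \<phi> (K_class p q r u) = word_eval H e u"
  unfolding group_K_def K_class_def
proof (rule presented_group_universal[OF K_relators_carrier H e])
  interpret group H by fact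
  fix u assume "word_class u \<in> K_relators p q r"
  then obtain x where "word_class u = word_class (replicate (gen_order p q r x) (x, True))"
    unfolding free_gen_pow by (metis gen_order.simps insertE singletonD)
  then have "free_eq (replicate (gen_order p q r x) (x, True)) u"
    unfolding word_class_eq using free_eq.refl by blast
  then show "word_eval H e u = \<one>\<^bsub>H\<^esub>"
    using word_eval_free_eq[OF e] word_eval_replicate[OF e] ord by metis
qed

lemma K_gen_pow: "K_gen p q r x [^]\<^bsub>group_K p q r\<^esub> gen_order p q r x = \<one>\<^bsub>group_K p q r\<^esub>"
proof -
  interpret group "group_K p q r" by (rule group_group_K)
  have "K_gen p q r x [^]\<^bsub>group_K p q r\<^esub> gen_order p q r x = K_class p q r (replicate (gen_order p q r x) (x, True))"
    using word_eval_replicate[of "K_gen p q r" "gen_order p q r x" x]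
    by (auto simp: word_eval_group_K carrier_group_K)
  also have "\<dots> = \<one>\<^bsub>group_K p q r\<^esub>"
    unfolding group_K_def K_class_def
    by (rule presented_class_relator[OF K_relators_carrier], cases x) (auto simp: free_gen_pow)
  finally show ?thesis .
qed

section \<open>The free product\<close>

definition fp_class :: "'i set \<Rightarrow> ('i \<Rightarrow> ('a, 'b) monoid_scheme) \<Rightarrow> ('i \<times> 'a) list \<Rightarrow> ('i \<times> 'a) list set" where
  "fp_class I G w = {(u, v). free_product_eq I G u v} `` {w}"

lemma fp_class_eq: "fp_class I G w = {v. free_product_eq I G w v}"
  by (auto simp: fp_class_def)

primrec fp_eval :: "('c, 'd) monoid_scheme \<Rightarrow> ('i \<Rightarrow> 'a \<Rightarrow> 'c) \<Rightarrow> ('i \<times> 'a) list \<Rightarrow> 'c" where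
  "fp_eval H h [] = \<one>\<^bsub>H\<^esub>"
| "fp_eval H h (l # u) = h (fst l) (snd l) \<otimes>\<^bsub>H\<^esub> fp_eval H h u"

locale free_product_of_groups =
  fixes I :: "'i set" and G :: "'i \<Rightarrow> ('a, 'b) monoid_scheme"
  assumes factor_group: "i \<in> I \<Longrightarrow> group (G i)"
begin

abbreviation W where "W \<equiv> lists (SIGMA i:I. carrier (G i))"

lemma free_product_eq_words: "free_product_eq I G u v \<Longrightarrow> u \<in> W \<and> v \<in> W"
proof (induction rule: free_product_eq.induct)
  case (unit u v i)
  then show ?case using group.is_monoid[OF factor_group[of i]] by auto
next
  case (merge u v i a b)
  then show ?case using monoid.m_closed[OF group.is_monoid[OF factor_group[of i]]] by auto
qed auto

lemma word_congruence_free_product: "word_congruence W {(u, v). free_product_eq I G u v}"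
proof
  show "equiv W {(u, v). free_product_eq I G u v}"
  proof (intro equivI refl_onI symI transI)
    show "{(u, v). free_product_eq I G u v} \<subseteq> W \<times> W" using free_product_eq_words by blast
  qed (auto intro: free_product_eq.refl elim: free_product_eq.sym free_product_eq.trans)
  fix u u' v v'
  assume *: "(u, u') \<in> {(u, v). free_product_eq I G u v}" "(v, v') \<in> {(u, v). free_product_eq I G u v}"
  then have "free_product_eq I G (u @ v) (u' @ v)" "free_product_eq I G (u' @ v) (u' @ v')"
    using free_product_eq_words free_product_eq_context[of I G u u' "[]" v]
      free_product_eq_context[of I G v v' u' "[]"] by auto
  then show "(u @ v, u' @ v') \<in> {(u, v). free_product_eq I G u v}"
    using free_product_eq.trans by fastforce
qed auto

lemma free_product_simps:
  "carrier (free_product I G) = fp_class I G ` W"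
  "\<one>\<^bsub>free_product I G\<^esub> = fp_class I G []"
  "\<lbrakk>u \<in> W; v \<in> W\<rbrakk> \<Longrightarrow> fp_class I G u \<otimes>\<^bsub>free_product I G\<^esub> fp_class I G v = fp_class I G (u @ v)"
  using word_congruence.mult_class[OF word_congruence_free_product, of u v]
  by (auto simp: free_product_def word_quotient_def fp_class_def quotient_def)

lemma fp_class_eqI: "free_product_eq I G u v \<Longrightarrow> fp_class I G u = fp_class I G v"
  unfolding fp_class_eq using free_product_eq.sym free_product_eq.trans by fast

lemma factor_inclusion_hom:
  assumes i: "i \<in> I" shows "(\<lambda>a. fp_class I G [(i, a)]) \<in> hom (G i) (free_product I G)"
proof (rule homI)
  interpret Gi: group "G i" by (rule factor_group[OF i])
  fix a b assume ab: "a \<in> carrier (G i)" "b \<in> carrier (G i)"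
  show "fp_class I G [(i, a)] \<in> carrier (free_product I G)"
    using ab i by (auto simp: free_product_simps)
  have "free_product_eq I G [(i, a), (i, b)] [(i, a \<otimes>\<^bsub>G i\<^esub> b)]"
    using free_product_eq.merge[of "[]" I G "[]" i a b] i ab by simp
  then show "fp_class I G [(i, a \<otimes>\<^bsub>G i\<^esub> b)] = fp_class I G [(i, a)] \<otimes>\<^bsub>free_product I G\<^esub> fp_class I G [(i, b)]"
    using ab i by (simp add: free_product_simps fp_class_eqI)
qed

lemma free_product_universal:
  assumes H: "group H" and h: "\<And>i. i \<in> I \<Longrightarrow> h i \<in> hom (G i) H"
  shows "\<exists>\<phi>\<in>hom (free_product I G) H. \<forall>w\<in>W. \<phi> (fp_class I G w) = fp_eval H h w"
proof -
  interpret H: group H by (rule H)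
  have hc: "h i a \<in> carrier H" if "i \<in> I" "a \<in> carrier (G i)" for i a
    using h[OF that(1)] that(2) by (auto simp: hom_def)
  have cl: "fp_eval H h w \<in> carrier H" if "w \<in> W" for w
    using that by (induction w) (auto simp: hc)
  have app: "fp_eval H h (u @ v) = fp_eval H h u \<otimes>\<^bsub>H\<^esub> fp_eval H h v" if "u \<in> W" "v \<in> W" for u v
    using that
  proof (induction u)
    case (Cons l u)
    then have "fp_eval H h u \<in> carrier H" "h (fst l) (snd l) \<in> carrier H"
      using cl[of u] hc by auto
    then show ?case using Cons cl[of v] by (simp add: H.m_assoc)
  qed (simp add: cl)
  have resp: "fp_eval H h u = fp_eval H h v" if "free_product_eq I G u v" for u v
    using that
  proof (induction rule: free_product_eq.induct)
    case (unit u v i)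
    interpret hi: group_hom "G i" H "h i" by (rule group_homI[OF factor_group H h]) (use unit in auto)
    show ?case using unit by (simp add: app cl)
  next
    case (merge u v i a b)
    interpret hi: group_hom "G i" H "h i" by (rule group_homI[OF factor_group H h]) (use merge in auto)
    show ?case using merge by (simp add: app cl H.m_assoc)
  qed auto
  define \<phi> where "\<phi> C = fp_eval H h (SOME w. w \<in> C)" for C
  have \<phi>: "\<phi> (fp_class I G w) = fp_eval H h w" if "w \<in> W" for w
    unfolding \<phi>_def fp_class_eq
    by (rule someI2[of _ w]) (use that in \<open>auto intro: free_product_eq.refl resp[symmetric]\<close>)
  have "\<phi> \<in> hom (free_product I G) H"
  proof (rule homI)
    fix C D assume "C \<in> carrier (free_product I G)" "D \<in> carrier (free_product I G)"
    then obtain u v where uv: "u \<in> W" "v \<in> W" "C = fp_class I G u" "D = fp_class I G v"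
      unfolding free_product_simps(1) by blast
    then show "\<phi> C \<in> carrier H" using \<phi> cl by metis
    have "u @ v \<in> W" using uv by simp
    then show "\<phi> (C \<otimes>\<^bsub>free_product I G\<^esub> D) = \<phi> C \<otimes>\<^bsub>H\<^esub> \<phi> D"
      unfolding uv(3,4) free_product_simps(3)[OF uv(1,2)] by (simp only: \<phi> app uv)
  qed
  then show ?thesis using \<phi> by blast
qed

end

lemma (in group) int_pow_hom_integer_mod_group:
  assumes x: "x \<in> carrier G" "x [^] n = \<one>" and n: "n > 0"
  shows "(\<lambda>a::int. x [^] a) \<in> hom (integer_mod_group n) G"
proof (rule homI)
  fix a b :: int
  have "x [^] (a + b) = x [^] (int n * ((a + b) div int n)) \<otimes> x [^] ((a + b) mod int n)"
    using x(1) by (simp flip: int_pow_mult)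
  also have "x [^] (int n * ((a + b) div int n)) = \<one>"
    using x by (simp flip: int_pow_pow add: int_pow_int)
  finally show "x [^] (a \<otimes>\<^bsub>integer_mod_group n\<^esub> b) = x [^] a \<otimes> x [^] b"
    using x(1) by (simp add: int_pow_mult)
qed (use x in auto)

text \<open>Mutually inverse homomorphisms come from the two universal properties. One composite fixes the
  generators of the presentation. The other fixes every one-letter word \<open>(i, a)\<close>, because the
  residue \<open>a\<close> is the \<open>a\<close>-th power of the residue \<open>1\<close>.\<close>

lemma group_K_iso_free_product:
  assumes "p > 1" "q > 1" "r > 1"
  shows "group_K p q r \<cong> free_product {0..<3} (\<lambda>i. integer_mod_group ([p, q, r] ! i))"
proof -
  define n where "n i = [p, q, r] ! i" for i
  let ?C = "\<lambda>i. integer_mod_group (n i)"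
  let ?F = "free_product {0..<3} ?C" and ?K = "group_K p q r"
  interpret FP: free_product_of_groups "{0..<3}" ?C
    by (rule free_product_of_groups.intro) (rule group_integer_mod_group)
  interpret F: group ?F by (rule group_free_product) simp
  interpret K: group ?K by (rule group_group_K)
  define idx where "idx x = (case x of Gen_x \<Rightarrow> 0 | Gen_y \<Rightarrow> 1 | Gen_z \<Rightarrow> (2::nat))" for x
  define gen where "gen i = (if i = 0 then Gen_x else if i = 1 then Gen_y else Gen_z)" for i :: nat
  have gen_idx: "gen (idx x) = x" for x by (cases x) (auto simp: gen_def idx_def)
  have idx3: "idx x \<in> {0..<3}" for x by (cases x) (auto simp: idx_def)
  have ord: "gen_order p q r (gen i) = n i" "idx (gen i) = i" "n i > 1" if "i \<in> {0..<3}" for i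
  proof -
    have "i = 0 \<or> i = 1 \<or> i = 2" using that by auto
    then show "gen_order p q r (gen i) = n i" "idx (gen i) = i" "n i > 1"
      using assms by (auto simp: n_def gen_def idx_def)
  qed
  define \<iota> where "\<iota> i a = fp_class {0..<3} ?C [(i, a)]" for i a
  have \<iota>: "group_hom (?C i) ?F (\<iota> i)" if "i \<in> {0..<3}" for i
    unfolding \<iota>_def using FP.factor_inclusion_hom[OF that] by (intro group_homI) (simp_all add: F.is_group)
  have one_in: "1 \<in> carrier (?C i)" if "i \<in> {0..<3}" for i using ord(3)[OF that] by simp
  define e where "e x = \<iota> (idx x) 1" for x
  have e: "range e \<subseteq> carrier ?F"
    unfolding e_def using group_hom.hom_closed[OF \<iota> one_in] idx3 by blast
  have e_pow: "e (gen i) [^]\<^bsub>?F\<^esub> a = \<iota> i (a mod int (n i))" if "i \<in> {0..<3}" for i and a :: int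
    using group_hom.hom_int_pow[OF \<iota>[OF that] one_in[OF that], of a]
    by (simp add: e_def ord[OF that] int_pow_integer_mod_group)
  have "\<exists>\<phi>\<in>hom ?K ?F. \<forall>u. \<phi> (K_class p q r u) = word_eval ?F e u"
  proof (rule group_K_universal[OF F.is_group e])
    fix x
    have "e x [^]\<^bsub>?F\<^esub> int (gen_order p q r x) = \<iota> (idx x) 0"
      using e_pow[OF idx3, of x] ord(1)[OF idx3, of x] by (simp add: gen_idx)
    also have "\<dots> = \<one>\<^bsub>?F\<^esub>" using group_hom.hom_one[OF \<iota>[OF idx3[of x]]] by simp
    finally show "e x [^]\<^bsub>?F\<^esub> gen_order p q r x = \<one>\<^bsub>?F\<^esub>" by (simp add: int_pow_int)
  qed
  then obtain \<phi> where \<phi>: "\<phi> \<in> hom ?K ?F" "\<And>u. \<phi> (K_class p q r u) = word_eval ?F e u" by blast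
  interpret \<phi>: group_hom ?K ?F \<phi> by (rule group_homI[OF K.is_group F.is_group \<phi>(1)])
  have Kg: "K_gen p q r x \<in> carrier ?K" for x by (simp add: carrier_group_K)
  define h where "h i = (\<lambda>a::int. K_gen p q r (gen i) [^]\<^bsub>?K\<^esub> a)" for i
  have "h i \<in> hom (?C i) ?K" if "i \<in> {0..<3}" for i
    unfolding h_def using K_gen_pow[of p q r "gen i"] ord[OF that]
    by (intro K.int_pow_hom_integer_mod_group Kg) auto
  then obtain \<psi> where \<psi>: "\<psi> \<in> hom ?F ?K" "\<And>w. w \<in> FP.W \<Longrightarrow> \<psi> (fp_class {0..<3} ?C w) = fp_eval ?K h w"
    using FP.free_product_universal[OF K.is_group, of h] by blast
  interpret \<psi>: group_hom ?F ?K \<psi> by (rule group_homI[OF F.is_group K.is_group \<psi>(1)])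
  have \<psi>e: "\<psi> (e x) = K_gen p q r x" for x
    using one_in[OF idx3] idx3[of x] Kg by (simp add: e_def \<iota>_def \<psi>(2) h_def gen_idx)
  have \<psi>\<phi>: "\<psi> (\<phi> g) = g" if "g \<in> carrier ?K" for g
  proof -
    have "g \<in> range (K_class p q r)" using that by (simp add: carrier_group_K)
    then obtain u where "g = K_class p q r u" by blast
    then show ?thesis using \<psi>.hom_word_eval[OF e, of u] by (simp add: \<phi>(2) o_def \<psi>e word_eval_group_K)
  qed
  have \<phi>h: "\<phi> (h i a) = \<iota> i a" if "i \<in> {0..<3}" "a \<in> carrier (?C i)" for i a
  proof -
    have "\<phi> (h i a) = \<phi> (K_gen p q r (gen i)) [^]\<^bsub>?F\<^esub> a" unfolding h_def by (rule \<phi>.hom_int_pow[OF Kg])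
    also have "\<phi> (K_gen p q r (gen i)) = e (gen i)"
      using subsetD[OF e rangeI, of "gen i"] by (simp add: \<phi>(2))
    finally show ?thesis using that ord(3)[OF that(1)] by (simp add: e_pow carrier_integer_mod_group)
  qed
  have hc: "h i a \<in> carrier ?K" for i a unfolding h_def by (rule K.int_pow_closed[OF Kg])
  have fpc: "fp_eval ?K h w \<in> carrier ?K" for w by (induction w) (auto simp: hc)
  have \<phi>\<psi>: "\<phi> (fp_eval ?K h w) = fp_class {0..<3} ?C w" if "w \<in> FP.W" for w
    using that
  proof (induction w)
    case Nil
    then show ?case by (simp add: FP.free_product_simps)
  next
    case (Cons l w)
    then have "fp_class {0..<3} ?C (l # w) = \<iota> (fst l) (snd l) \<otimes>\<^bsub>?F\<^esub> fp_class {0..<3} ?C w"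
      using FP.free_product_simps(3)[of "[l]" w] by (simp add: \<iota>_def)
    then show ?case using Cons by (auto simp: \<phi>h hc fpc)
  qed
  have "\<phi> \<in> iso ?K ?F"
  proof (rule isoI[OF \<phi>(1)])
    show "bij_betw \<phi> (carrier ?K) (carrier ?F)"
    proof (rule bij_betw_byWitness[where f' = \<psi>])
      show "\<forall>g\<in>carrier ?F. \<phi> (\<psi> g) = g" using \<phi>\<psi> \<psi>(2) by (auto simp: FP.free_product_simps(1) simp del: lists.simps)
    qed (use \<psi>\<phi> in auto)
  qed
  then show ?thesis unfolding n_def[symmetric] by (rule is_isoI)
qed

section \<open>Cyclic quotients and the abelianisation\<close>

lemma word_eval_integer_mod_group:
  assumes "range e \<subseteq> carrier (integer_mod_group n)"
  shows "word_eval (integer_mod_group n) e u =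
    (exponent_sum Gen_x u * e Gen_x + exponent_sum Gen_y u * e Gen_y + exponent_sum Gen_z u * e Gen_z) mod int n"
  using comm_group.word_eval_xyz[OF abelian_integer_mod_group assms]
  by (simp add: int_pow_integer_mod_group mod_simps)

text \<open>Kill the two other generators: the image of a word in the remaining cyclic group is the residue of
  one exponent sum.\<close>

lemma finitely_annihilated_exponent_sum:
  assumes "gen_order p q r x > 1" and dvd: "int (gen_order p q r x) dvd exponent_sum x u"
  shows "finitely_annihilated_element (group_K p q r) (K_class p q r u)"
proof -
  let ?n = "gen_order p q r x"
  let ?H = "integer_mod_group ?n"
  define e :: "xyz \<Rightarrow> int" where "e y = (if y = x then 1 else 0)" for y
  have e: "range e \<subseteq> carrier ?H" using assms(1) by (auto simp: e_def)
  have "\<exists>\<phi>\<in>hom (group_K p q r) ?H. \<forall>u. \<phi> (K_class p q r u) = word_eval ?H e u"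
    by (rule group_K_universal[OF group_integer_mod_group e]) (auto simp: e_def)
  then obtain \<phi> where \<phi>: "\<phi> \<in> hom (group_K p q r) ?H" "\<And>u. \<phi> (K_class p q r u) = word_eval ?H e u" by blast
  have "\<phi> (K_class p q r u) = exponent_sum x u mod ?n"
    unfolding \<phi>(2) word_eval_integer_mod_group[OF e] by (cases x) (simp_all add: e_def)
  then have 1: "\<phi> (K_class p q r u) = \<one>\<^bsub>?H\<^esub>" using dvd by simp
  have "\<phi> (K_gen p q r x) = 1"
    unfolding \<phi>(2) word_eval_integer_mod_group[OF e] using assms(1) by (cases x) (simp_all add: e_def)
  then have 2: "\<phi> ` carrier (group_K p q r) \<noteq> {\<one>\<^bsub>?H\<^esub>}"
    unfolding carrier_group_K by (metis image_eqI one_integer_mod_group rangeI singletonD zero_neq_one)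
  show ?thesis
    by (rule finitely_annihilated_elementI[OF group_group_K group_integer_mod_group _ \<phi>(1) _ 1 2])
      (use assms(1) in \<open>auto simp: carrier_group_K carrier_integer_mod_group\<close>)
qed

lemma cyclic_integer_mod_group: "cyclic_group (integer_mod_group n)"
proof (cases "n = 1")
  case True
  then show ?thesis by (simp add: trivial_imp_cyclic_group trivial_integer_mod_group)
next
  case False
  have "carrier (integer_mod_group n) = range (\<lambda>k::int. 1 [^]\<^bsub>integer_mod_group n\<^esub> k)"
  proof
    show "carrier (integer_mod_group n) \<subseteq> range (\<lambda>k::int. 1 [^]\<^bsub>integer_mod_group n\<^esub> k)"
    proof
      fix k assume "k \<in> carrier (integer_mod_group n)"
      then have "k = 1 [^]\<^bsub>integer_mod_group n\<^esub> k"
        by (simp add: int_pow_integer_mod_group carrier_integer_mod_group split: if_splits)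
      then show "k \<in> range (\<lambda>k::int. 1 [^]\<^bsub>integer_mod_group n\<^esub> k)" by (rule range_eqI)
    qed
    show "range (\<lambda>k::int. 1 [^]\<^bsub>integer_mod_group n\<^esub> k) \<subseteq> carrier (integer_mod_group n)"
      using False by (auto intro!: group.int_pow_closed)
  qed
  then show ?thesis
    using False unfolding group.cyclic_group[OF group_integer_mod_group] by (intro bexI[of _ 1]) auto
qed

text \<open>The map \<open>x, y, z \<mapsto> qr, pr, pq\<close> is onto by the Bezout identity. If a word has image \<open>0\<close>,
  reducing modulo \<open>p\<close>, \<open>q\<close> and \<open>r\<close> in turn shows that each exponent sum is divisible by the order of
  its generator, so the word is trivial in the abelianisation. Hence the kernel is exactly the derived
  subgroup.\<close>

lemma abelianisation_group_K:
  assumes pos: "p > 0" "q > 0" "r > 0" and cop: "coprime p q" "coprime p r" "coprime q r"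
  shows "abelianisation (group_K p q r) \<cong> integer_mod_group (p * q * r)"
proof -
  let ?K = "group_K p q r" and ?H = "integer_mod_group (p * q * r)"
  let ?n = "gen_order p q r"
  let ?D = "derived ?K (carrier ?K)"
  interpret K: group ?K by (rule group_group_K)
  interpret H: comm_group ?H by (rule abelian_integer_mod_group)
  define c :: "xyz \<Rightarrow> int" where "c x = (case x of Gen_x \<Rightarrow> int (q * r) | Gen_y \<Rightarrow> int (p * r) | Gen_z \<Rightarrow> int (p * q))" for x
  define e where "e x = c x mod int (p * q * r)" for x
  have e: "range e \<subseteq> carrier ?H" using pos by (auto simp: e_def carrier_integer_mod_group)
  have cn: "int (?n x) * c x = int (p * q * r)" for x by (cases x) (auto simp: c_def)
  have "\<exists>\<phi>\<in>hom ?K ?H. \<forall>u. \<phi> (K_class p q r u) = word_eval ?H e u"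
  proof (rule group_K_universal[OF group_integer_mod_group e])
    show "e x [^]\<^bsub>?H\<^esub> ?n x = \<one>\<^bsub>?H\<^esub>" for x
      by (simp only: e_def pow_integer_mod_group mod_mult_right_eq cn) simp
  qed
  then obtain \<phi> where \<phi>: "\<phi> \<in> hom ?K ?H" "\<And>u. \<phi> (K_class p q r u) = word_eval ?H e u" by blast
  interpret \<phi>: group_hom ?K ?H \<phi> by (rule group_homI[OF K.is_group H.is_group \<phi>(1)])
  have Kg: "K_gen p q r x \<in> carrier ?K" for x by (simp add: carrier_group_K)
  have \<phi>_pow: "\<phi> (K_gen p q r x [^]\<^bsub>?K\<^esub> (i::int)) = i * c x mod int (p * q * r)" for x i
  proof -
    have "\<phi> (K_gen p q r x) = e x" by (simp add: \<phi>(2) e_def)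
    then show ?thesis
      by (simp add: \<phi>.hom_int_pow[OF Kg] int_pow_integer_mod_group e_def mod_simps)
  qed
  have surj: "\<phi> ` carrier ?K = carrier ?H"
  proof
    show "carrier ?H \<subseteq> \<phi> ` carrier ?K"
    proof
      fix k assume k: "k \<in> carrier ?H"
      have "coprime (int p) (int q)" "coprime (int r) (int (p * q))"
        using cop by (simp_all add: coprime_commute)
      then obtain x y s t where b: "x * int p + y * int q = 1" "s * int r + t * int (p * q) = 1"
        using bezout_int[of "int p" "int q"] bezout_int[of "int r" "int (p * q)"] by auto
      have "(s * y) * c Gen_x + (s * x) * c Gen_y + t * c Gen_z
          = s * int r * (x * int p + y * int q) + t * int (p * q)"
        by (simp add: c_def algebra_simps)
      also have "\<dots> = 1" using b by simp
      finally have 1: "(s * y) * c Gen_x + (s * x) * c Gen_y + t * c Gen_z = 1" .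
      let ?g = "K_gen p q r Gen_x [^]\<^bsub>?K\<^esub> (k * (s * y)) \<otimes>\<^bsub>?K\<^esub> K_gen p q r Gen_y [^]\<^bsub>?K\<^esub> (k * (s * x))
          \<otimes>\<^bsub>?K\<^esub> K_gen p q r Gen_z [^]\<^bsub>?K\<^esub> (k * t)"
      have "\<phi> ?g = (k * ((s * y) * c Gen_x + (s * x) * c Gen_y + t * c Gen_z)) mod int (p * q * r)"
        using Kg by (simp add: \<phi>_pow mod_simps) (simp add: algebra_simps)
      also have "\<dots> = k" using k pos unfolding 1 by (simp add: carrier_integer_mod_group)
      finally show "k \<in> \<phi> ` carrier ?K" using Kg by (metis (no_types) K.int_pow_closed K.m_closed image_eqI)
    qed
  qed auto
  have "kernel ?K ?H \<phi> = ?D"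
  proof
    have "\<phi> ` ?D = {\<one>\<^bsub>?H\<^esub>}"
      using \<phi>.derived_img[OF subset_refl] H.derived_eq_singleton[OF equalityD1[OF surj]] by simp
    then show "?D \<subseteq> kernel ?K ?H \<phi>"
      using K.derived_in_carrier[of "carrier ?K"] by (auto simp: kernel_def)
    interpret D: normal ?D ?K by (rule K.derived_self_is_normal)
    let ?Q = "?K Mod ?D"
    interpret Q: comm_group ?Q by (rule K.derived_quot_is_comm_group)
    let ?\<pi> = "\<lambda>g. ?D #>\<^bsub>?K\<^esub> g"
    interpret \<pi>: group_hom ?K ?Q ?\<pi> by (rule group_homI[OF K.is_group Q.is_group D.r_coset_hom_Mod])
    show "kernel ?K ?H \<phi> \<subseteq> ?D"
    proof
      fix g assume g: "g \<in> kernel ?K ?H \<phi>"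
      then obtain u where u: "g = K_class p q r u" by (auto simp: kernel_def carrier_group_K)
      have gK: "g \<in> carrier ?K" using g by (simp add: kernel_def)
      let ?s = "\<lambda>x. exponent_sum x u"
      have "(?s Gen_x * c Gen_x + ?s Gen_y * c Gen_y + ?s Gen_z * c Gen_z) mod int (p * q * r) = 0"
      proof -
        have "(?s Gen_x * e Gen_x + ?s Gen_y * e Gen_y + ?s Gen_z * e Gen_z) mod int (p * q * r) = 0"
          using g unfolding u kernel_def by (simp add: \<phi>(2) word_eval_integer_mod_group[OF e])
        moreover have "(?s Gen_x * e Gen_x + ?s Gen_y * e Gen_y + ?s Gen_z * e Gen_z) mod int (p * q * r) =
            (?s Gen_x * c Gen_x + ?s Gen_y * c Gen_y + ?s Gen_z * c Gen_z) mod int (p * q * r)"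
          unfolding e_def by (intro mod_add_cong mod_mult_cong HOL.refl mod_mod_trivial)
        ultimately show ?thesis by simp
      qed
      then have dvd: "int (p * q * r) dvd ?s Gen_x * int (q * r) + ?s Gen_y * int (p * r) + ?s Gen_z * int (p * q)"
        by (simp add: c_def mod_eq_0_iff_dvd)
      have "int (?n x) dvd ?s x" for x
      proof (cases x)
        case Gen_x
        have "int p dvd ?s Gen_x * int (q * r) + ?s Gen_y * int (p * r) + ?s Gen_z * int (p * q)"
          using dvd by (metis dvd_mult_left mult.assoc of_nat_mult)
        then have "int p dvd ?s Gen_x * int (q * r)"
          by (simp add: dvd_add_left_iff)
        moreover have "coprime (int p) (int (q * r))" using cop by simp
        ultimately show ?thesis using Gen_x by (simp add: coprime_dvd_mult_left_iff)
      next
        case Gen_y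
        have "int q dvd ?s Gen_x * int (q * r) + ?s Gen_y * int (p * r) + ?s Gen_z * int (p * q)"
          using dvd by (metis dvd_mult_left dvd_mult_right of_nat_mult)
        then have "int q dvd ?s Gen_y * int (p * r)"
          by (simp add: dvd_add_left_iff dvd_add_right_iff)
        moreover have "coprime (int q) (int (p * r))" using cop by (simp add: coprime_commute)
        ultimately show ?thesis using Gen_y by (simp add: coprime_dvd_mult_left_iff)
      next
        case Gen_z
        have "int r dvd ?s Gen_x * int (q * r) + ?s Gen_y * int (p * r) + ?s Gen_z * int (p * q)"
          using dvd by (metis dvd_mult_right of_nat_mult)
        then have "int r dvd ?s Gen_z * int (p * q)"
          by (simp add: dvd_add_right_iff)
        moreover have "coprime (int r) (int (p * q))" using cop by (simp add: coprime_commute)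
        ultimately show ?thesis using Gen_z by (simp add: coprime_dvd_mult_left_iff)
      qed
      then have trivial: "?\<pi> (K_gen p q r x) [^]\<^bsub>?Q\<^esub> ?s x = \<one>\<^bsub>?Q\<^esub>" for x
      proof -
        obtain k where k: "?s x = int (?n x) * k" using \<open>int (?n x) dvd ?s x\<close> by (rule dvdE)
        have "K_gen p q r x [^]\<^bsub>?K\<^esub> ?s x = \<one>\<^bsub>?K\<^esub>"
          using K.int_pow_pow[OF Kg, of x "int (?n x)" k] by (simp add: k int_pow_int K_gen_pow)
        then show ?thesis using \<pi>.hom_int_pow[OF Kg, of x "?s x"] \<pi>.hom_one by simp
      qed
      have Kg': "range (K_gen p q r) \<subseteq> carrier ?K" using Kg by blast
      have r: "range (?\<pi> \<circ> K_gen p q r) \<subseteq> carrier ?Q" using Kg \<pi>.hom_closed by auto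
      have "?\<pi> g = word_eval ?Q (?\<pi> \<circ> K_gen p q r) u"
        using \<pi>.hom_word_eval[OF Kg', of u] by (simp add: u word_eval_group_K)
      also have "\<dots> = \<one>\<^bsub>?Q\<^esub>"
        unfolding Q.word_eval_xyz[OF r] by (simp only: o_def trivial Q.r_one Q.one_closed)
      finally have "?D #>\<^bsub>?K\<^esub> g = ?D" by (simp add: FactGroup_def)
      then show "g \<in> ?D" using K.coset_join1 gK D.is_subgroup by blast
    qed
  qed
  then show ?thesis unfolding abelianisation_def using \<phi>.FactGroup_iso[OF surj] by simp
qed

lemma cyclic_group_iso:
  assumes "G \<cong> H" "group G" "group H" "cyclic_group H"
  shows "cyclic_group G"
proof -
  obtain h where "h \<in> iso H G" using group.iso_sym[OF assms(2,1)] by (auto simp: is_iso_def)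
  then have "h \<in> epi H G" by (simp add: iso_iff_mon_epi)
  then show ?thesis using group.cyclic_group_epimorphic_image[OF assms(3)] assms(2,4) by blast
qed

section \<open>Axially symmetric self-maps of the sphere\<close>

text \<open>The sphere is taken in \<open>\<real> \<times> \<complex>\<close>, with the axis as the real factor. A rotation about
  the axis is then multiplication of the second component by a complex number of modulus one.\<close>

definition S2 :: "(real \<times> complex) set" where "S2 = sphere 0 1"

lemma in_S2: "(s, b) \<in> S2 \<longleftrightarrow> s\<^sup>2 + (cmod b)\<^sup>2 = 1"
  by (simp add: S2_def norm_prod_def)

lemma S2_iff: "v \<in> S2 \<longleftrightarrow> (fst v)\<^sup>2 + (cmod (snd v))\<^sup>2 = 1"
  by (cases v) (simp add: in_S2)

text \<open>The Brouwer degree is defined for the sphere in the space of real sequences that vanish beyond a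
  fixed index; the next two maps are mutually inverse homeomorphisms.\<close>

definition to_nsphere :: "real \<times> complex \<Rightarrow> nat \<Rightarrow> real" where
  "to_nsphere v = (\<lambda>i. if i = 0 then fst v else if i = 1 then Re (snd v) else if i = 2 then Im (snd v) else 0)"

definition of_nsphere :: "(nat \<Rightarrow> real) \<Rightarrow> real \<times> complex" where
  "of_nsphere x = (x 0, Complex (x 1) (x 2))"

lemma topspace_nsphere2: "x \<in> topspace (nsphere 2) \<longleftrightarrow> (x 0)\<^sup>2 + (x 1)\<^sup>2 + (x 2)\<^sup>2 = 1 \<and> (\<forall>i>2. x i = 0)"
  by (simp add: nsphere numeral_2_eq_2)

lemma to_of_nsphere: "x \<in> topspace (nsphere 2) \<Longrightarrow> to_nsphere (of_nsphere x) = x"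
  by (auto simp: topspace_nsphere2 of_nsphere_def to_nsphere_def fun_eq_iff)

lemma continuous_to_nsphere: "continuous_map (top_of_set S2) (nsphere 2) to_nsphere"
proof -
  have "continuous_map (top_of_set S2) (powertop_real UNIV) to_nsphere"
    unfolding continuous_map_componentwise_UNIV
  proof
    fix k :: nat
    consider "k = 0" | "k = 1" | "k = 2" | "k > 2" by linarith
    then show "continuous_map (top_of_set S2) euclideanreal (\<lambda>x. to_nsphere x k)"
      by cases (auto simp: to_nsphere_def intro!: continuous_intros)
  qed
  moreover have "to_nsphere ` S2 \<subseteq> {x. (\<Sum>i\<le>2. x i ^ 2) = 1 \<and> (\<forall>i>2. x i = 0)}"
    by (auto simp: to_nsphere_def S2_iff cmod_power2 atMost_nat_numeral atMost_Suc)
  ultimately show ?thesis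
    unfolding nsphere by (auto simp: continuous_map_in_subtopology)
qed

lemma continuous_of_nsphere: "continuous_map (nsphere 2) (top_of_set S2) of_nsphere"
proof -
  have c: "continuous_map (nsphere 2) euclidean (\<lambda>x. f (x k))"
    if "continuous_on UNIV f" for f :: "real \<Rightarrow> 'a::topological_space" and k
    using continuous_map_compose[OF continuous_map_nsphere_projection, of euclidean f] that
    by (auto simp: o_def)
  have "continuous_map (nsphere 2) euclidean (\<lambda>x. of_real (x 1) + \<i> * of_real (x 2))"
    by (intro continuous_map_add c continuous_intros)
  then have "continuous_map (nsphere 2) euclidean of_nsphere"
    unfolding of_nsphere_def prod_topology_euclidean[symmetric] Complex_eq
    by (intro continuous_map_pairedI continuous_map_nsphere_projection) auto
  moreover have "of_nsphere ` topspace (nsphere 2) \<subseteq> S2"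
    by (auto simp: of_nsphere_def topspace_nsphere2 in_S2 cmod_power2)
  ultimately show ?thesis by (auto simp: continuous_map_in_subtopology)
qed

text \<open>The two maps have Brouwer degrees \<open>1\<close> and \<open>- 1\<close>.\<close>

lemma id_not_homotopic_reflection:
  "\<not> homotopic_with_canon (\<lambda>_. True) S2 S2 (\<lambda>v. v) (\<lambda>v. (- fst v, snd v))"
proof
  assume "homotopic_with_canon (\<lambda>_. True) S2 S2 (\<lambda>v. v) (\<lambda>v. (- fst v, snd v))"
  then have "homotopic_with (\<lambda>_. True) (nsphere 2) (nsphere 2)
     (to_nsphere \<circ> ((\<lambda>v. v) \<circ> of_nsphere)) (to_nsphere \<circ> ((\<lambda>v. (- fst v, snd v)) \<circ> of_nsphere))"
    by (blast intro: homotopic_with_compose_continuous_map_left homotopic_with_compose_continuous_map_right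
        continuous_to_nsphere continuous_of_nsphere)
  then have "Brouwer_degree2 2 (to_nsphere \<circ> ((\<lambda>v. v) \<circ> of_nsphere)) =
       Brouwer_degree2 2 (to_nsphere \<circ> ((\<lambda>v. (- fst v, snd v)) \<circ> of_nsphere))"
    by (rule Brouwer_degree2_homotopic)
  also have "Brouwer_degree2 2 (to_nsphere \<circ> ((\<lambda>v. v) \<circ> of_nsphere)) = Brouwer_degree2 2 id"
    by (rule Brouwer_degree2_eq) (simp add: to_of_nsphere)
  also have "Brouwer_degree2 2 (to_nsphere \<circ> ((\<lambda>v. (- fst v, snd v)) \<circ> of_nsphere)) =
     Brouwer_degree2 2 (\<lambda>x i. if i = 0 then -x i else x i)"
    by (rule Brouwer_degree2_eq) (auto simp: topspace_nsphere2 to_nsphere_def of_nsphere_def fun_eq_iff)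
  finally show False by (simp add: Brouwer_degree2_reflection)
qed

text \<open>Equivariance under all rotations about the axis.\<close>

definition axial :: "(real \<times> complex \<Rightarrow> real \<times> complex) \<Rightarrow> bool" where
  "axial f \<longleftrightarrow> (\<forall>s b u. (s, b) \<in> S2 \<longrightarrow> cmod u = 1 \<longrightarrow> f (s, u * b) = (fst (f (s, b)), u * snd (f (s, b))))"

text \<open>An axial map is determined by its restriction to one meridian, a path between the images of the
  poles. The sphere is simply connected, so two such paths with the same end points are homotopic
  with fixed end points. Rotating this homotopy of paths about the axis gives a homotopy of axial maps. It is
  continuous at the poles since there the component to be rotated tends to \<open>0\<close>.\<close>

lemma axial_homotopic:
  assumes f: "continuous_on S2 f" "f ` S2 \<subseteq> S2" "axial f"
    and g: "continuous_on S2 g" "g ` S2 \<subseteq> S2" "axial g"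
    and N: "f (1, 0) = g (1, 0)" "snd (g (1,0)) = 0" and S: "f (-1, 0) = g (-1, 0)" "snd (g (-1,0)) = 0"
  shows "homotopic_with_canon (\<lambda>_. True) S2 S2 f g"
proof -
  \<comment> \<open>a meridian from the south pole to the north pole, parametrised by height\<close>
  define m :: "real \<Rightarrow> real \<times> complex" where "m = (\<lambda>x. (2 * x - 1, of_real (sqrt (1 - (2*x-1)\<^sup>2))))"
  have sq: "(2 * x - 1)\<^sup>2 \<le> 1" if "x \<in> {0..1}" for x :: real
    using that by (auto simp: abs_square_le_1)
  have m: "m x \<in> S2" if "x \<in> {0..1}" for x
    using sq[OF that] by (simp add: m_def in_S2)
  have mc: "continuous_on {0..1} m"
    unfolding m_def by (intro continuous_intros)
  have path: "path (k \<circ> m) \<and> path_image (k \<circ> m) \<subseteq> S2" if "continuous_on S2 k" "k ` S2 \<subseteq> S2" for k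
  proof
    show "path (k \<circ> m)" unfolding path_def
      by (rule continuous_on_compose[OF mc continuous_on_subset[OF that(1)]]) (use m in blast)
    show "path_image (k \<circ> m) \<subseteq> S2" unfolding path_image_def using m that(2) by fastforce
  qed
  have "simply_connected S2" unfolding S2_def by (rule simply_connected_sphere) simp
  then have "homotopic_paths S2 (f \<circ> m) (g \<circ> m)"
    unfolding simply_connected_eq_homotopic_paths using path[OF f(1,2)] path[OF g(1,2)] N S
    by (auto simp: pathstart_def pathfinish_def m_def)
  then obtain h :: "real \<times> real \<Rightarrow> real \<times> complex" where h: "continuous_on ({0..1} \<times> {0..1}) h" "h \<in> ({0..1} \<times> {0..1}) \<rightarrow> S2"
    and h01: "\<forall>x\<in>{0..1}. h (0, x) = f (m x)" "\<forall>x\<in>{0..1}. h (1, x) = g (m x)"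
    and ends: "\<forall>t\<in>{0..1}. h (t, 0) = f (m 0) \<and> h (t, 1) = f (m 1)"
    unfolding homotopic_paths pathstart_def pathfinish_def o_def by blast
  define k :: "real \<times> real \<times> complex \<Rightarrow> real \<times> real" where "k = (\<lambda>(t, s, b). (t, (s + 1) / 2))"
  \<comment> \<open>rotate the path homotopy; as \<open>sgn 0 = 0\<close>, nothing has to be chosen at the poles\<close>
  define H where "H = (\<lambda>y. (fst (h (k y)), sgn (snd (snd y)) * snd (h (k y))))"
  have s1: "\<bar>s\<bar> \<le> 1" if "(s, b) \<in> S2" for s b
    using that unfolding in_S2 by (metis abs_square_le_1 le_add_same_cancel1 zero_le_power2)
  have k: "k y \<in> {0..1} \<times> {0..1}" if y: "y \<in> {0..1} \<times> S2" for y
  proof -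
    obtain t s b where "y = (t, s, b)" "t \<in> {0..1}" "(s, b) \<in> S2" using y by (cases y) auto
    then show ?thesis using s1[of s b] by (simp add: k_def abs_le_iff)
  qed
  have kc: "continuous_on ({0..1::real} \<times> S2) (\<lambda>y. h (k y))"
  proof (rule continuous_on_compose2[OF h(1)])
    show "continuous_on ({0..1::real} \<times> S2) k"
      unfolding k_def case_prod_unfold by (intro continuous_intros) auto
  qed (use k in blast)
  \<comment> \<open>the path homotopy fixes the end points, which lie on the axis\<close>
  have pole: "snd (h (k y)) = 0" if y: "y \<in> {0..1} \<times> S2" and b: "snd (snd y) = 0" for y
  proof -
    obtain t s where y': "y = (t, s, 0)" "t \<in> {0..1}" "(s, 0) \<in> S2" using y b by (cases y) auto
    have "s = 1 \<or> s = -1" using y'(3) unfolding in_S2 by (simp add: power2_eq_1_iff)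
    then show ?thesis using ends[rule_format, OF y'(2)] N S by (auto simp: y' k_def m_def)
  qed
  have Hc: "continuous_on ({0..1::real} \<times> S2) H"
    unfolding H_def
  proof (rule continuous_on_Pair[OF continuous_on_fst[OF kc]])
    show "continuous_on ({0..1::real} \<times> S2) (\<lambda>y. sgn (snd (snd y)) * snd (h (k y)))"
      unfolding continuous_on_eq_continuous_within
    proof
      fix y assume y: "y \<in> {0..1::real} \<times> S2"
      have hc: "continuous (at y within {0..1::real} \<times> S2) (\<lambda>y. snd (h (k y)))"
        by (rule continuous_snd[OF kc[unfolded continuous_on_eq_continuous_within, THEN bspec, OF y]])
      show "continuous (at y within {0..1::real} \<times> S2) (\<lambda>y. sgn (snd (snd y)) * snd (h (k y)))"
      proof (cases "snd (snd y) = 0")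
        case False
        then show ?thesis
          unfolding continuous_within
          by (intro tendsto_mult[OF _ hc[unfolded continuous_within]] tendsto_sgn tendsto_snd tendsto_ident_at)
      next
        case True
        have "((\<lambda>y. snd (h (k y))) \<longlongrightarrow> 0) (at y within {0..1::real} \<times> S2)"
          using hc pole[OF y True] by (simp add: continuous_within)
        then have "((\<lambda>y. sgn (snd (snd y)) * snd (h (k y))) \<longlongrightarrow> 0) (at y within {0..1::real} \<times> S2)"
          by (rule Lim_null_comparison[rotated, OF tendsto_norm_zero])
            (auto simp: norm_mult norm_sgn)
        then show ?thesis using True by (simp add: continuous_within)
      qed
    qed
  qed
  have HS: "H y \<in> S2" if y: "y \<in> {0..1} \<times> S2" for y
  proof -
    have "h (k y) \<in> S2" using h(2) k[OF y] by (rule funcset_mem)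
    then have *: "(fst (h (k y)))\<^sup>2 + (cmod (snd (h (k y))))\<^sup>2 = 1" by (metis in_S2 prod.collapse)
    then show ?thesis using pole[OF y]
      by (cases "snd (snd y) = 0") (auto simp: H_def in_S2 norm_mult norm_sgn)
  qed
  have val: "(fst (w (m ((s+1)/2))), sgn b * snd (w (m ((s+1)/2)))) = w (s, b)"
    if w: "axial w" "snd (w (1,0)) = 0" "snd (w (-1,0)) = 0" and v: "(s, b) \<in> S2" for w s b
  proof -
    have "1 - s\<^sup>2 = (cmod b)\<^sup>2" using v unfolding in_S2 by linarith
    then have "sqrt (1 - s\<^sup>2) = cmod b" by (simp only: real_sqrt_abs abs_norm_cancel)
    moreover have "2 * ((s + 1) / 2) - 1 = s" by (simp add: field_simps)
    ultimately have m': "m ((s+1)/2) = (s, of_real (cmod b))" unfolding m_def by (simp only:)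
    show ?thesis
    proof (cases "b = 0")
      case True
      then have "s = 1 \<or> s = -1" using v unfolding in_S2 by (simp add: power2_eq_1_iff)
      then show ?thesis unfolding m' using w(2,3) True by (auto simp: prod_eq_iff)
    next
      case False
      then have "w (s, sgn b * of_real (cmod b)) = (fst (w (s, of_real (cmod b))), sgn b * snd (w (s, of_real (cmod b))))"
        using w(1) v unfolding axial_def in_S2 by (simp add: norm_sgn)
      moreover have "sgn b * of_real (cmod b) = b" using False by (simp add: sgn_eq)
      ultimately show ?thesis unfolding m' by simp
    qed
  qed
  have ends01: "H (0, v) = f v" "H (1, v) = g v" if v: "v \<in> S2" for v
  proof -
    have x: "(fst v + 1) / 2 \<in> {0..1}" using k[of "(0, v)"] v by (auto simp: k_def case_prod_unfold)
    have sv: "(fst v, snd v) \<in> S2" using v by simp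
    have g0: "snd (g (1, 0)) = 0" "snd (g (-1, 0)) = 0" and f0: "snd (f (1, 0)) = 0" "snd (f (-1, 0)) = 0"
      using N S by simp_all
    have "h (k (0, v)) = f (m ((fst v + 1) / 2))" "h (k (1, v)) = g (m ((fst v + 1) / 2))"
      using h01[THEN bspec, OF x] by (simp_all add: k_def case_prod_unfold)
    then show "H (0, v) = f v" "H (1, v) = g v"
      using val[OF f(3) f0 sv] val[OF g(3) g0 sv] by (simp_all add: H_def)
  qed
  show ?thesis
    unfolding homotopic_with_def
  proof (intro exI[of _ "\<lambda>y. if fst y = 0 then f (snd y) else if fst y = 1 then g (snd y) else H y"] conjI allI ballI)
    show "continuous_map (prod_topology (top_of_set {0..1}) (top_of_set S2)) (top_of_set S2)
       (\<lambda>y. if fst y = 0 then f (snd y) else if fst y = 1 then g (snd y) else H y)"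
    proof (rule continuous_map_eq[of _ _ H])
      show "continuous_map (prod_topology (top_of_set {0..1}) (top_of_set S2)) (top_of_set S2) H"
        using Hc HS by (auto simp flip: subtopology_Times simp: image_subset_iff)
    qed (auto simp: ends01)
  qed simp_all
qed

text \<open>The map that fixes the poles is homotopic to the identity, the one that exchanges them to the
  reflection in the equatorial plane.\<close>

lemma axial_swap_fix_not_homotopic:
  assumes f: "axial f" "f (1, 0) = (-1, 0)" "f (-1, 0) = (1, 0)"
    and g: "axial g" "g (1, 0) = (1, 0)" "g (-1, 0) = (-1, 0)"
    and fg: "homotopic_with_canon (\<lambda>_. True) S2 S2 f g"
  shows False
proof -
  have f': "continuous_on S2 f" "f ` S2 \<subseteq> S2" and g': "continuous_on S2 g" "g ` S2 \<subseteq> S2"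
    using homotopic_with_imp_continuous[OF fg] homotopic_with_imp_subset1[OF fg] homotopic_with_imp_subset2[OF fg]
    by auto
  have "homotopic_with_canon (\<lambda>_. True) S2 S2 g (\<lambda>v. v)"
    by (rule axial_homotopic) (use g g' in \<open>auto simp: axial_def\<close>)
  moreover have "homotopic_with_canon (\<lambda>_. True) S2 S2 f (\<lambda>v. (- fst v, snd v))"
    by (rule axial_homotopic) (use f f' in \<open>auto simp: axial_def S2_iff intro!: continuous_intros\<close>)
  ultimately show False
    using fg id_not_homotopic_reflection homotopic_with_trans homotopic_with_sym by blast
qed

section \<open>Finitely generated subrings of a field are residually finite\<close>

locale unital_subring =
  fixes A :: "'a::field_char_0 set"
  assumes one_mem: "1 \<in> A"
    and diff_mem: "\<lbrakk>x \<in> A; y \<in> A\<rbrakk> \<Longrightarrow> x - y \<in> A"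
    and mult_mem: "\<lbrakk>x \<in> A; y \<in> A\<rbrakk> \<Longrightarrow> x * y \<in> A"
begin

lemma zero_mem: "0 \<in> A"
  using diff_mem[OF one_mem one_mem] by simp

lemma uminus_mem: "x \<in> A \<Longrightarrow> - x \<in> A"
  using diff_mem[OF zero_mem, of x] by simp

lemma add_mem: "\<lbrakk>x \<in> A; y \<in> A\<rbrakk> \<Longrightarrow> x + y \<in> A"
  using diff_mem[of x "- y"] uminus_mem by simp

lemma power_mem: "x \<in> A \<Longrightarrow> x ^ n \<in> A"
  by (induction n) (simp_all add: one_mem mult_mem)

lemma sum_mem: "(\<And>i. i \<in> N \<Longrightarrow> f i \<in> A) \<Longrightarrow> sum f N \<in> A"
  by (induction N rule: infinite_finite_induct) (auto simp: zero_mem add_mem)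

end

definition coeffs_in :: "'a::zero set \<Rightarrow> 'a poly set" where
  "coeffs_in A = {f. \<forall>i. coeff f i \<in> A}"

lemma coeffs_inI: "(\<And>i. coeff f i \<in> A) \<Longrightarrow> f \<in> coeffs_in A"
  by (simp add: coeffs_in_def)

lemma coeffs_inD: "f \<in> coeffs_in A \<Longrightarrow> coeff f i \<in> A"
  by (simp add: coeffs_in_def)

definition adjoin :: "'a::comm_semiring_1 set \<Rightarrow> 'a \<Rightarrow> 'a set" where
  "adjoin A a = (\<lambda>f. poly f a) ` coeffs_in A"

locale finite_index_ideal = unital_subring A for A :: "'a::field_char_0 set" +
  fixes I :: "'a set"
  assumes ideal_sub: "I \<subseteq> A"
    and ideal_zero: "0 \<in> I"
    and ideal_diff: "\<lbrakk>x \<in> I; y \<in> I\<rbrakk> \<Longrightarrow> x - y \<in> I"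
    and ideal_mult: "\<lbrakk>x \<in> A; y \<in> I\<rbrakk> \<Longrightarrow> x * y \<in> I"
    and proper: "1 \<notin> I"
    and finite_index: "\<exists>S. finite S \<and> S \<subseteq> A \<and> (\<forall>x\<in>A. \<exists>s\<in>S. x - s \<in> I)"
begin

lemma ideal_uminus: "x \<in> I \<Longrightarrow> - x \<in> I"
  using ideal_diff[OF ideal_zero, of x] by simp

lemma ideal_add: "\<lbrakk>x \<in> I; y \<in> I\<rbrakk> \<Longrightarrow> x + y \<in> I"
  using ideal_diff[of x "- y"] ideal_uminus by simp

lemma ideal_mult': "\<lbrakk>x \<in> I; y \<in> A\<rbrakk> \<Longrightarrow> x * y \<in> I"
  using ideal_mult[of y x] by (simp add: mult.commute)

lemma ideal_sum: "(\<And>i. i \<in> N \<Longrightarrow> f i \<in> I) \<Longrightarrow> sum f N \<in> I"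
  by (induction N rule: infinite_finite_induct) (auto simp: ideal_zero ideal_add)

lemma unit_cancel: "\<lbrakk>x \<in> A; c * e - 1 \<in> I; e \<in> A; x * c \<in> I\<rbrakk> \<Longrightarrow> x \<in> I"
proof -
  assume a: "x \<in> A" "c * e - 1 \<in> I" "e \<in> A" "x * c \<in> I"
  have "x * c * e - x * (c * e - 1) \<in> I"
    by (rule ideal_diff[OF ideal_mult'[OF a(4,3)] ideal_mult[OF a(1,2)]])
  then show "x \<in> I" by (simp add: algebra_simps)
qed

lemma unit_power_notin: "\<lbrakk>c \<in> A; c * e - 1 \<in> I; e \<in> A\<rbrakk> \<Longrightarrow> c ^ k \<notin> I"
proof (induction k)
  case (Suc k)
  then show ?case using unit_cancel[of "c ^ k" c e] by (auto simp: mult.commute power_mem)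
qed (simp add: proper)

end

text \<open>Asking for \<open>d\<close> to become invertible, and not just nonzero, in a finite quotient is what makes the
  property pass from a ring to an extension by one element: leading coefficients become units,
  so that division by polynomials is possible modulo the ideal.\<close>

definition residually_finite_ring :: "'a::field_char_0 set \<Rightarrow> bool" where
  "residually_finite_ring A \<longleftrightarrow>
    (\<forall>d\<in>A. d \<noteq> 0 \<longrightarrow> (\<exists>I. finite_index_ideal A I \<and> (\<exists>e\<in>A. d * e - 1 \<in> I)))"

text \<open>Reduce modulo a prime larger than the given integer.\<close>

lemma residually_finite_ring_Ints: "residually_finite_ring (\<int> :: 'a::field_char_0 set)"
  unfolding residually_finite_ring_def
proof (intro ballI impI)
  fix d :: 'a assume "d \<in> \<int>" "d \<noteq> 0"
  then obtain k :: int where k: "d = of_int k" "k \<noteq> 0" by (auto elim: Ints_cases)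
  obtain l :: nat where l: "prime l" "l > nat \<bar>k\<bar>" using bigger_prime by blast
  have "\<not> int l dvd k" using l k dvd_imp_le_int[of k "int l"] by auto
  then have "coprime k (int l)"
    using l(1) by (metis coprime_commute prime_imp_coprime prime_int_nat_transfer prime_nat_int_transfer)
  then obtain e where e: "[k * e = 1] (mod int l)" using cong_solve_coprime_int by blast
  define I :: "'a set" where "I = (\<lambda>j. of_int (int l * j)) ` UNIV"
  have "finite_index_ideal \<int> I"
  proof
    show "x - y \<in> I" if xy: "x \<in> I" "y \<in> I" for x y
    proof -
      obtain i j where "x = of_int (int l * i)" "y = of_int (int l * j)" using xy unfolding I_def by blast
      then have "x - y = of_int (int l * (i - j))" by (simp add: algebra_simps)
      then show ?thesis unfolding I_def by blast
    qed
    show "x * y \<in> I" if xy: "x \<in> \<int>" "y \<in> I" for x y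
    proof -
      obtain i j where "x = of_int i" "y = of_int (int l * j)"
        using xy unfolding I_def by (blast elim: Ints_cases)
      then have "x * y = of_int (int l * (i * j))" by (simp add: algebra_simps)
      then show ?thesis unfolding I_def by blast
    qed
    show "0 \<in> I" unfolding I_def by (rule image_eqI[of _ _ 0]) auto
    show "1 \<notin> I"
    proof
      assume "1 \<in> I"
      then obtain j where "(1::'a) = of_int (int l * j)" unfolding I_def by blast
      then have "1 = int l * j" by (metis of_int_1 of_int_eq_iff)
      then have "int l dvd 1" by (metis dvd_triv_left)
      then show False using l(1) by (simp add: prime_nat_iff)
    qed
    show "\<exists>S. finite S \<and> S \<subseteq> \<int> \<and> (\<forall>x\<in>\<int>. \<exists>s\<in>S. x - s \<in> I)"
    proof (intro exI[of _ "of_int ` {0..<int l}"] conjI ballI)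
      fix x :: 'a assume "x \<in> \<int>"
      then obtain i where i: "x = of_int i" by (auto elim: Ints_cases)
      have "x - of_int (i mod int l) = of_int (int l * (i div int l))"
        unfolding i by (simp flip: of_int_diff add: minus_mod_eq_mult_div)
      then show "\<exists>s\<in>of_int ` {0..<int l}. x - s \<in> I"
        using l(1) prime_gt_0_nat unfolding I_def by (intro bexI[of _ "of_int (i mod int l)"]) auto
    qed auto
  qed (auto simp: I_def)
  moreover have "d * of_int e - 1 \<in> I"
  proof -
    have "int l dvd k * e - 1" using e by (simp add: cong_iff_dvd_diff)
    then obtain j where "k * e - 1 = int l * j" by auto
    then have "d * of_int e - 1 = of_int (int l * j)" unfolding k by (metis of_int_1 of_int_diff of_int_mult)
    then show ?thesis unfolding I_def by blast
  qed
  ultimately show "\<exists>I. finite_index_ideal \<int> I \<and> (\<exists>e\<in>\<int>. d * e - 1 \<in> I)"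
    by (intro exI[of _ I] conjI bexI[of _ "of_int e"]) auto
qed

context unital_subring
begin

lemma coeffs_in_one: "1 \<in> coeffs_in A"
  by (auto simp: coeffs_in_def coeff_pCons zero_mem one_mem one_pCons split: nat.split)

lemma coeffs_in_zero: "0 \<in> coeffs_in A"
  by (auto simp: coeffs_in_def zero_mem)

lemma coeffs_in_pCons: "\<lbrakk>c \<in> A; f \<in> coeffs_in A\<rbrakk> \<Longrightarrow> pCons c f \<in> coeffs_in A"
  by (auto simp: coeffs_in_def coeff_pCons split: nat.split)

lemma coeffs_in_monom: "c \<in> A \<Longrightarrow> monom c n \<in> coeffs_in A"
  by (auto simp: coeffs_in_def zero_mem)

lemma coeffs_in_smult: "\<lbrakk>c \<in> A; f \<in> coeffs_in A\<rbrakk> \<Longrightarrow> smult c f \<in> coeffs_in A"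
  by (auto simp: coeffs_in_def mult_mem)

lemma coeffs_in_diff: "\<lbrakk>f \<in> coeffs_in A; g \<in> coeffs_in A\<rbrakk> \<Longrightarrow> f - g \<in> coeffs_in A"
  by (auto simp: coeffs_in_def diff_mem)

lemma coeffs_in_uminus: "f \<in> coeffs_in A \<Longrightarrow> - f \<in> coeffs_in A"
  by (auto simp: coeffs_in_def uminus_mem)

lemma coeffs_in_add: "\<lbrakk>f \<in> coeffs_in A; g \<in> coeffs_in A\<rbrakk> \<Longrightarrow> f + g \<in> coeffs_in A"
  by (auto simp: coeffs_in_def add_mem)

lemma coeffs_in_mult: "\<lbrakk>f \<in> coeffs_in A; g \<in> coeffs_in A\<rbrakk> \<Longrightarrow> f * g \<in> coeffs_in A"
  by (auto simp: coeffs_in_def coeff_mult intro!: sum_mem mult_mem)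

lemmas coeffs_in_intros = coeffs_in_one coeffs_in_zero coeffs_in_pCons coeffs_in_monom coeffs_in_smult
  coeffs_in_diff coeffs_in_uminus coeffs_in_add coeffs_in_mult

lemma unital_subring_adjoin: "unital_subring (adjoin A a)"
proof
  show "1 \<in> adjoin A a" unfolding adjoin_def by (rule image_eqI[of _ _ 1]) (auto intro: coeffs_in_one)
  fix x y assume "x \<in> adjoin A a" "y \<in> adjoin A a"
  then obtain f g where fg: "f \<in> coeffs_in A" "g \<in> coeffs_in A" "x = poly f a" "y = poly g a"
    unfolding adjoin_def by auto
  show "x - y \<in> adjoin A a" unfolding adjoin_def
    by (rule image_eqI[of _ _ "f - g"]) (use fg in \<open>auto intro: coeffs_in_diff\<close>)
  show "x * y \<in> adjoin A a" unfolding adjoin_def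
    by (rule image_eqI[of _ _ "f * g"]) (use fg in \<open>auto intro: coeffs_in_mult\<close>)
qed

lemma subset_adjoin: "A \<subseteq> adjoin A a"
  unfolding adjoin_def by (auto intro!: image_eqI[of _ _ "[:_:]"] coeffs_in_intros)

lemma mem_adjoin: "a \<in> adjoin A a"
  unfolding adjoin_def by (auto intro!: image_eqI[of _ _ "[:0, 1:]"] coeffs_in_intros zero_mem one_mem)

text \<open>Division with remainder works over a ring after multiplication by a power of the leading
  coefficient of the divisor.\<close>

lemma pseudo_division:
  assumes "f \<in> coeffs_in A" "m \<in> coeffs_in A" "m \<noteq> 0"
  shows "\<exists>k q r. q \<in> coeffs_in A \<and> r \<in> coeffs_in A \<and> smult (lead_coeff m ^ k) f = q * m + r \<and>
     (r = 0 \<or> degree r < degree m)"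
  using assms(1)
proof (induction "degree f" arbitrary: f rule: less_induct)
  case less
  show ?case
  proof (cases "f = 0 \<or> degree f < degree m")
    case True
    then show ?thesis using less.prems
      by (intro exI[of _ 0] exI[of _ "0::'a poly"] exI[of _ f]) (auto intro: coeffs_in_intros)
  next
    case False
    define t where "t = monom (lead_coeff f) (degree f - degree m)"
    define f' where "f' = smult (lead_coeff m) f - t * m"
    have t: "t \<in> coeffs_in A" unfolding t_def using less.prems by (intro coeffs_in_intros coeffs_inD)
    have f': "f' \<in> coeffs_in A"
      unfolding f'_def using t less.prems assms(2) by (intro coeffs_in_intros coeffs_inD)
    have "\<exists>k q r. q \<in> coeffs_in A \<and> r \<in> coeffs_in A \<and> smult (lead_coeff m ^ k) f' = q * m + r \<and>
     (r = 0 \<or> degree r < degree m)"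
    proof (cases "f' = 0")
      case True
      then show ?thesis by (intro exI[of _ 0] exI[of _ "0::'a poly"]) (auto intro: coeffs_in_intros)
    next
      case f0: False
      have 1: "degree f' \<le> degree f"
        unfolding f'_def t_def using False
        by (intro degree_diff_le order.trans[OF degree_smult_le] order.trans[OF degree_mult_le])
          (auto intro: order.trans[OF add_right_mono[OF degree_monom_le]])
      have "coeff f' (degree f) = 0"
        unfolding f'_def t_def using False by (simp add: coeff_monom_mult)
      then have "degree f' \<noteq> degree f" using f0 by (metis leading_coeff_0_iff)
      with 1 have "degree f' < degree f" by simp
      then show ?thesis using less.hyps f' by blast
    qed
    then obtain k q r where q: "q \<in> coeffs_in A" "r \<in> coeffs_in A"
      "smult (lead_coeff m ^ k) f' = q * m + r" "r = 0 \<or> degree r < degree m" by blast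
    have "smult (lead_coeff m ^ Suc k) f = smult (lead_coeff m ^ k) (f' + t * m)"
      by (simp add: f'_def mult.commute)
    also have "\<dots> = (q + smult (lead_coeff m ^ k) t) * m + r"
      using q(3) by (simp add: algebra_simps smult_add_right)
    finally show ?thesis
      using q t assms(2) by (intro exI[of _ "Suc k"] exI[of _ "q + smult (lead_coeff m ^ k) t"] exI[of _ r])
        (auto intro!: coeffs_in_intros power_mem coeffs_inD)
  qed
qed

end

context finite_index_ideal
begin

text \<open>Modulo \<open>I\<close> the leading coefficient of \<open>m\<close> is a unit, so a nonzero multiple of \<open>m\<close> has degree at
  least \<open>degree m\<close>. A constant multiple therefore vanishes. This is what keeps the ideals constructed
  below proper.\<close>

lemma constant_in_ideal:
  assumes m: "m \<in> coeffs_in A" "degree m > 0" and e: "lead_coeff m * e - 1 \<in> I" "e \<in> A"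
    and q: "q \<in> coeffs_in A" and c: "c \<in> A" "q * m - [:c:] \<in> coeffs_in I"
  shows "c \<in> I"
proof -
  have qI: "coeff q j \<in> I" for j
  proof (rule ccontr)
    assume "coeff q j \<notin> I"
    define J where "J = {j. coeff q j \<notin> I}"
    have fin: "finite J" 
      by (rule finite_subset[of _ "{..degree q}"]) (auto simp: J_def ideal_zero intro: le_degree)
    have ne: "J \<noteq> {}" using \<open>coeff q j \<notin> I\<close> by (auto simp: J_def)
    \<comment> \<open>compare the coefficients of degree \<open>k + degree m\<close>, where \<open>k\<close> is the degree of \<open>q\<close> modulo \<open>I\<close>\<close>
    define k where "k = Max J"
    have k: "coeff q k \<notin> I" using Max_in[OF fin ne] by (auto simp: J_def k_def)
    have above: "coeff q i \<in> I" if "i > k" for i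
      using Max_ge[OF fin, of i] that by (auto simp: J_def k_def)
    let ?n = "degree m"
    have "coeff (q * m) (k + ?n) = (\<Sum>i\<le>k+?n. coeff q i * coeff m (k + ?n - i))"
      by (rule coeff_mult)
    also have "\<dots> = coeff q k * lead_coeff m + (\<Sum>i\<in>{..k+?n}-{k}. coeff q i * coeff m (k + ?n - i))"
      by (subst sum.remove[of _ k]) auto
    finally have "coeff q k * lead_coeff m = coeff (q * m) (k + ?n) - (\<Sum>i\<in>{..k+?n}-{k}. coeff q i * coeff m (k + ?n - i))"
      by simp
    also have "\<dots> \<in> I"
    proof (intro ideal_diff ideal_sum)
      show "coeff (q * m) (k + ?n) \<in> I"
        using coeffs_inD[OF c(2), of "k + ?n"] m(2) by (simp add: coeff_pCons split: nat.splits)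
      fix i assume i: "i \<in> {..k+?n}-{k}"
      show "coeff q i * coeff m (k + ?n - i) \<in> I"
      proof (cases "i > k")
        case True
        then show ?thesis using above m(1) by (intro ideal_mult') (auto intro: coeffs_inD)
      next
        case False
        then have "coeff m (k + ?n - i) = 0" using i by (intro coeff_eq_0) auto
        then show ?thesis by (simp add: ideal_zero)
      qed
    qed
    finally show False using k unit_cancel[OF coeffs_inD[OF q] e, of k] by blast
  qed
  have "coeff (q * m) 0 \<in> I"
    unfolding coeff_mult using qI m(1) by (intro ideal_sum ideal_mult') (auto intro: coeffs_inD)
  moreover have "coeff (q * m) 0 - c \<in> I" using coeffs_inD[OF c(2), of 0] by simp
  ultimately show ?thesis using ideal_diff by fastforce
qed

text \<open>Since \<open>m\<close> is monic up to a unit modulo \<open>I\<close> and vanishes at \<open>a\<close> modulo \<open>J\<close>, every element is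
  congruent modulo \<open>J\<close> to a polynomial in \<open>a\<close> of degree less than \<open>degree m\<close>, with coefficients
  taken from a finite set of representatives for \<open>I\<close>.\<close>

lemma finite_index_ideal_adjoin:
  assumes sub: "I \<subseteq> J" "J \<subseteq> adjoin A a" and diff: "\<And>x y. \<lbrakk>x \<in> J; y \<in> J\<rbrakk> \<Longrightarrow> x - y \<in> J"
    and mult: "\<And>x y. \<lbrakk>x \<in> adjoin A a; y \<in> J\<rbrakk> \<Longrightarrow> x * y \<in> J" and "1 \<notin> J"
    and m: "m \<in> coeffs_in A" "degree m > 0" "poly m a \<in> J"
    and e: "lead_coeff m * e - 1 \<in> I" "e \<in> A"
  shows "finite_index_ideal (adjoin A a) J"
proof -
  interpret B: unital_subring "adjoin A a" by (rule unital_subring_adjoin)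
  let ?n = "degree m"
  have J0: "0 \<in> J" using sub ideal_zero by blast
  have add: "x + y \<in> J" if "x \<in> J" "y \<in> J" for x y
    using diff[OF that(1) diff[OF J0 that(2)]] by simp
  have sumJ: "sum f N \<in> J" if "\<And>i. i \<in> N \<Longrightarrow> f i \<in> J" for f :: "nat \<Rightarrow> 'a" and N
    using that by (induction N rule: infinite_finite_induct) (auto simp: J0 add)
  have AB: "x \<in> adjoin A a" if "x \<in> A" for x using that subset_adjoin by blast
  \<comment> \<open>modulo \<open>J\<close>, \<open>poly r0 a\<close> represents the power of \<open>a\<close> with exponent \<open>degree m\<close>\<close>
  define r0 where "r0 = smult (- e) (m - monom (lead_coeff m) ?n)"
  have r0: "r0 \<in> coeffs_in A" unfolding r0_def using m e by (intro coeffs_in_intros uminus_mem coeffs_inD)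
  have deg_r0: "coeff r0 i = 0" if "i \<ge> ?n" for i
    using that by (cases "i = ?n") (auto simp: r0_def coeff_eq_0)
  have "a ^ ?n - poly r0 a = e * poly m a - (lead_coeff m * e - 1) * a ^ ?n"
    by (simp add: r0_def poly_monom algebra_simps)
  also have "\<dots> \<in> J"
    using e sub m(3) mult[OF AB] mult[OF B.power_mem[OF mem_adjoin], of "lead_coeff m * e - 1" ?n]
    by (intro diff) (auto simp: mult.commute)
  finally have r0J: "a ^ ?n - poly r0 a \<in> J" .
  have red: "\<exists>r\<in>coeffs_in A. (\<forall>i\<ge>?n. coeff r i = 0) \<and> poly f a - poly r a \<in> J" if "f \<in> coeffs_in A" for f
    using that
  proof (induction f)
    case 0
    then show ?case using J0 by (auto intro!: bexI[of _ 0] coeffs_in_intros)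
  next
    case (pCons c f)
    have "f \<in> coeffs_in A" "c \<in> A" using coeffs_inD[OF pCons.prems, of "Suc _"] coeffs_inD[OF pCons.prems, of 0]
      by (auto intro: coeffs_inI)
    with pCons.IH obtain r where r: "r \<in> coeffs_in A" "\<forall>i\<ge>?n. coeff r i = 0" "poly f a - poly r a \<in> J" by blast
    define t where "t = coeff (pCons c r) ?n"
    define r' where "r' = pCons c r - monom t ?n + smult t r0"
    have tA: "t \<in> A" unfolding t_def using r(1) \<open>c \<in> A\<close> by (intro coeffs_inD coeffs_in_pCons)
    have "r' \<in> coeffs_in A"
      unfolding r'_def using r(1) \<open>c \<in> A\<close> tA r0 by (intro coeffs_in_intros)
    moreover have "coeff r' i = 0" if "i \<ge> ?n" for i
      using that r(2) deg_r0[OF that] m(2) by (cases "i = ?n") (auto simp: r'_def t_def coeff_pCons split: nat.splits)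
    moreover have "poly (pCons c f) a - poly r' a = a * (poly f a - poly r a) + t * (a ^ ?n - poly r0 a)"
      by (simp add: r'_def poly_monom algebra_simps)
    moreover have "\<dots> \<in> J"
      by (intro add mult mem_adjoin AB tA r r0J)
    ultimately show ?case by metis
  qed
  obtain S where S: "finite S" "S \<subseteq> A" "\<And>x. x \<in> A \<Longrightarrow> \<exists>s\<in>S. x - s \<in> I" using finite_index by blast
  define T where "T = (\<lambda>s. \<Sum>i<?n. s i * a ^ i) ` ({..<?n} \<rightarrow>\<^sub>E S)"
  have "finite T" unfolding T_def using S(1) by (intro finite_imageI finite_PiE) auto
  moreover have "T \<subseteq> adjoin A a"
  proof -
    have "(\<Sum>i<?n. s i * a ^ i) \<in> adjoin A a" if "s \<in> {..<?n} \<rightarrow>\<^sub>E S" for s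
      using that S(2) by (intro B.sum_mem B.mult_mem B.power_mem mem_adjoin AB) auto
    then show ?thesis unfolding T_def by blast
  qed
  moreover have "\<exists>s\<in>T. x - s \<in> J" if x: "x \<in> adjoin A a" for x
  proof -
    obtain f where f: "f \<in> coeffs_in A" "x = poly f a" using x unfolding adjoin_def by auto
    obtain r where r: "r \<in> coeffs_in A" "\<forall>i\<ge>?n. coeff r i = 0" "poly f a - poly r a \<in> J" using red f by blast
    obtain s where s: "\<And>i. s i \<in> S \<and> coeff r i - s i \<in> I" using S(3)[OF coeffs_inD[OF r(1)]] by metis
    have "degree r \<le> ?n - 1" using r(2) m(2) by (intro degree_le) auto
    then have "poly r a = (\<Sum>i<?n. coeff r i * a ^ i)"
      unfolding poly_altdef using r(2) m(2)
      by (intro sum.mono_neutral_left) (auto simp: coeff_eq_0)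
    then have "x - (\<Sum>i<?n. restrict s {..<?n} i * a ^ i) = (poly f a - poly r a) + (\<Sum>i<?n. a ^ i * (coeff r i - s i))"
      by (simp add: f sum_subtractf algebra_simps)
    moreover have "\<dots> \<in> J"
      by (intro add r sumJ mult B.power_mem mem_adjoin) (use s sub in blast)
    ultimately have "x - (\<Sum>i<?n. restrict s {..<?n} i * a ^ i) \<in> J" by (rule ssubst)
    moreover have "restrict s {..<?n} \<in> {..<?n} \<rightarrow>\<^sub>E S" using s by auto
    ultimately show ?thesis unfolding T_def
      by (rule bexI[OF _ imageI])
  qed
  ultimately have fin: "\<exists>S. finite S \<and> S \<subseteq> adjoin A a \<and> (\<forall>x\<in>adjoin A a. \<exists>s\<in>S. x - s \<in> J)"
    by (intro exI[of _ T] conjI ballI)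
  show ?thesis
    by (unfold_locales, rule sub(2), rule J0, erule (1) diff, erule (1) mult, rule \<open>1 \<notin> J\<close>, rule fin)
qed

lemma coeffs_in_ideal_mult: "\<lbrakk>f \<in> coeffs_in A; g \<in> coeffs_in I\<rbrakk> \<Longrightarrow> f * g \<in> coeffs_in I"
  by (auto simp: coeffs_in_def coeff_mult intro!: ideal_sum ideal_mult)

lemma coeffs_in_ideal_diff: "\<lbrakk>f \<in> coeffs_in I; g \<in> coeffs_in I\<rbrakk> \<Longrightarrow> f - g \<in> coeffs_in I"
  by (auto simp: coeffs_in_def ideal_diff)

lemma coeffs_in_ideal_const: "c \<in> I \<Longrightarrow> [:c:] \<in> coeffs_in I"
  by (auto simp: coeffs_in_def coeff_pCons ideal_zero split: nat.split)

lemma coeffs_in_ideal_subset: "f \<in> coeffs_in I \<Longrightarrow> f \<in> coeffs_in A"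
  using ideal_sub by (auto simp: coeffs_in_def)

end

text \<open>The Euclidean algorithm for \<open>f\<close> and a polynomial \<open>m\<close> of minimal degree that vanishes at \<open>a\<close>. It
  ends in a nonzero constant, for otherwise a proper factor of \<open>m\<close> would vanish at \<open>a\<close>.\<close>

lemma (in unital_subring) algebraic_divides_constant:
  assumes m: "m \<in> coeffs_in A" "m \<noteq> 0" "poly m a = 0"
    and min: "\<And>f. \<lbrakk>f \<in> coeffs_in A; poly f a = 0; f \<noteq> 0\<rbrakk> \<Longrightarrow> degree m \<le> degree f"
    and f: "f \<in> coeffs_in A" "poly f a \<noteq> 0"
  shows "\<exists>g\<in>coeffs_in A. poly f a * poly g a \<in> A - {0}"
proof -
  have small: "\<exists>g\<in>coeffs_in A. poly f a * poly g a \<in> A - {0}"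
    if "f \<in> coeffs_in A" "poly f a \<noteq> 0" "degree f < degree m" for f
    using that
  proof (induction "degree f" arbitrary: f rule: less_induct)
    case less
    have f0: "f \<noteq> 0" using less.prems by auto
    show ?case
    proof (cases "degree f = 0")
      case True
      then obtain c where "f = [:c:]" by (auto elim: degree_eq_zeroE)
      then show ?thesis using less.prems coeffs_inD[OF less.prems(1), of 0]
        by (intro bexI[of _ 1]) (auto intro: coeffs_in_intros)
    next
      case False
      obtain k q r where qr: "q \<in> coeffs_in A" "r \<in> coeffs_in A" "smult (lead_coeff f ^ k) m = q * f + r"
        "r = 0 \<or> degree r < degree f"
        using pseudo_division[OF m(1) less.prems(1) f0] by blast
      have "poly (q * f + r) a = 0" using m(3) by (simp flip: qr(3))
      then have ev: "poly q a * poly f a + poly r a = 0" by simp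
      show ?thesis
      proof (cases "poly r a = 0")
        case True
        \<comment> \<open>here \<open>f\<close> divides \<open>m\<close> up to constants, so the quotient \<open>q\<close> is too small to vanish at \<open>a\<close>\<close>
        have r0: "r = 0"
          using min[OF qr(2) True] qr(4) less.prems(3) by (cases "r = 0") auto
        have q0: "q \<noteq> 0" using qr(3) r0 m(2) f0 by auto
        have "degree m = degree q + degree f"
          using arg_cong[OF qr(3), of degree] r0 q0 f0 by (simp add: degree_mult_eq)
        moreover have "poly q a = 0" using ev True less.prems(2) by simp
        ultimately show ?thesis using min[OF qr(1)] q0 False by force
      next
        case nz: False
        \<comment> \<open>apply the induction hypothesis to \<open>r\<close>, which is congruent to \<open>- q f\<close> modulo \<open>m\<close>\<close>
        have "degree r < degree f" using qr(4) nz by auto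
        then obtain g where g: "g \<in> coeffs_in A" "poly r a * poly g a \<in> A - {0}"
          using less.hyps[of r] qr(2) nz less.prems(3) by auto
        have "poly f a * poly (- q * g) a = poly r a * poly g a"
        proof -
          have "poly r a = - (poly q a * poly f a)" using ev by (metis add.commute eq_neg_iff_add_eq_0)
          then show ?thesis by simp
        qed
        moreover have "- q * g \<in> coeffs_in A" using g qr(1) by (intro coeffs_in_intros)
        ultimately show ?thesis using g(2) by metis
      qed
    qed
  qed
  obtain k q r where qr: "q \<in> coeffs_in A" "r \<in> coeffs_in A" "smult (lead_coeff m ^ k) f = q * m + r"
    "r = 0 \<or> degree r < degree m"
    using pseudo_division[OF f(1) m(1,2)] by blast
  have r: "poly r a = lead_coeff m ^ k * poly f a"
    using arg_cong[OF qr(3), of "\<lambda>p. poly p a"] m(3) by simp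
  then have "poly r a \<noteq> 0" using f(2) m(2) by simp
  moreover from this have "degree r < degree m" using qr(4) by auto
  ultimately obtain g where g: "g \<in> coeffs_in A" "poly r a * poly g a \<in> A - {0}"
    using small[OF qr(2)] by auto
  moreover have "poly f a * poly (smult (lead_coeff m ^ k) g) a = poly r a * poly g a" by (simp add: r)
  moreover have "smult (lead_coeff m ^ k) g \<in> coeffs_in A"
    using m(1) g by (intro coeffs_in_smult power_mem coeffs_inD)
  ultimately show ?thesis by metis
qed

text \<open>Let \<open>d = f(a)\<close> be nonzero. In each case a nonzero element \<open>c\<close> of \<open>A\<close> is made invertible modulo a
  finite-index ideal \<open>I\<close> of \<open>A\<close>, and \<open>J\<close> is an ideal of \<open>A[a]\<close> above \<open>I\<close>. If \<open>a\<close> is algebraic over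
  \<open>A\<close>, some nonzero multiple of \<open>d\<close> lies in \<open>A\<close>; take \<open>c\<close> to be this multiple times the leading coefficient
  of the minimal polynomial of \<open>a\<close>, and \<open>J = I A[a]\<close>. If \<open>a\<close> is transcendental, take for \<open>c\<close> the leading
  coefficient of \<open>f\<close> and for \<open>J\<close> the ideal generated by \<open>I\<close> and \<open>a f(a) - 1\<close>: this forces
  \<open>a\<close> to become the inverse of \<open>d\<close>, and \<open>X f - 1\<close> is a polynomial with leading coefficient \<open>c\<close>.\<close>

lemma (in unital_subring) residually_finite_ring_adjoin:
  assumes A: "residually_finite_ring A"
  shows "residually_finite_ring (adjoin A a)"
  unfolding residually_finite_ring_def
proof (intro ballI impI)
  interpret B: unital_subring "adjoin A a" by (rule unital_subring_adjoin)
  fix d assume d: "d \<in> adjoin A a" "d \<noteq> 0"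
  obtain f where f: "f \<in> coeffs_in A" "d = poly f a" using d unfolding adjoin_def by auto
  have polyB: "poly g a \<in> adjoin A a" if "g \<in> coeffs_in A" for g using that unfolding adjoin_def by blast
  have AB: "x \<in> adjoin A a" if "x \<in> A" for x using that subset_adjoin by blast
  show "\<exists>I. finite_index_ideal (adjoin A a) I \<and> (\<exists>e\<in>adjoin A a. d * e - 1 \<in> I)"
  proof (cases "\<exists>m\<in>coeffs_in A. m \<noteq> 0 \<and> poly m a = 0")
    case True
    obtain m where m: "m \<in> coeffs_in A" "m \<noteq> 0" "poly m a = 0"
      and min: "\<And>g. \<lbrakk>g \<in> coeffs_in A; poly g a = 0; g \<noteq> 0\<rbrakk> \<Longrightarrow> degree m \<le> degree g"
      using ex_has_least_nat[of "\<lambda>m. m \<in> coeffs_in A \<and> m \<noteq> 0 \<and> poly m a = 0" _ degree] True by blast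
    have degm: "degree m > 0" using m(2,3) by (cases "degree m") (auto elim: degree_eq_zeroE)
    obtain g where g: "g \<in> coeffs_in A" "d * poly g a \<in> A - {0}"
      using algebraic_divides_constant[OF m min f(1)] d f(2) by blast
    define c where "c = lead_coeff m * (d * poly g a)"
    have lcA: "lead_coeff m \<in> A" using m(1) by (rule coeffs_inD)
    have "c \<in> A" "c \<noteq> 0" using g m(2) lcA by (auto simp: c_def mult_mem)
    then obtain I e where I: "finite_index_ideal A I" "e \<in> A" "c * e - 1 \<in> I"
      using A unfolding residually_finite_ring_def by blast
    interpret I: finite_index_ideal A I by fact
    \<comment> \<open>inverse of the leading coefficient modulo \<open>I\<close>\<close>
    define e' where "e' = d * poly g a * e"
    have e': "e' \<in> A" "lead_coeff m * e' - 1 \<in> I"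
      using g I(2,3) mult_mem[of "d * poly g a" e] by (simp_all add: e'_def c_def mult.assoc)
    define J where "J = (\<lambda>h. poly h a) ` coeffs_in I"
    have IJ: "I \<subseteq> J" unfolding J_def by (auto intro!: image_eqI[of _ _ "[:_:]"] I.coeffs_in_ideal_const)
    have "finite_index_ideal (adjoin A a) J"
    proof (rule I.finite_index_ideal_adjoin[OF IJ _ _ _ _ m(1) degm _ e'(2,1)])
      show "J \<subseteq> adjoin A a" unfolding J_def using polyB I.coeffs_in_ideal_subset by blast
      show "x - y \<in> J" if "x \<in> J" "y \<in> J" for x y
        using that unfolding J_def by (auto simp flip: poly_diff intro!: imageI I.coeffs_in_ideal_diff)
      show "x * y \<in> J" if "x \<in> adjoin A a" "y \<in> J" for x y
        using that unfolding J_def adjoin_def by (auto simp flip: poly_mult intro!: imageI I.coeffs_in_ideal_mult)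
      show "poly m a \<in> J" using m(3) IJ I.ideal_zero by auto
      show "1 \<notin> J"
      proof
        assume "1 \<in> J"
        then obtain h where h: "h \<in> coeffs_in I" "poly h a = 1" unfolding J_def by force
        have "h - 1 \<in> coeffs_in A" using h(1) I.coeffs_in_ideal_subset by (intro coeffs_in_intros)
        then obtain k q r where qr: "q \<in> coeffs_in A" "r \<in> coeffs_in A"
          "smult (lead_coeff m ^ k) (h - 1) = q * m + r" "r = 0 \<or> degree r < degree m"
          using pseudo_division[OF _ m(1,2)] by blast
        have "poly r a = 0" using arg_cong[OF qr(3), of "\<lambda>p. poly p a"] m(3) h(2) by simp
        then have "r = 0" using min[OF qr(2)] qr(4) by (cases "r = 0") auto
        then have "q * m = smult (lead_coeff m ^ k) (h - 1)" using qr(3) by simp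
        then have "q * m - [:- (lead_coeff m ^ k):] = [:lead_coeff m ^ k:] * h"
          by (simp add: smult_diff_right one_pCons)
        moreover have "[:lead_coeff m ^ k:] * h \<in> coeffs_in I"
          using lcA h(1) by (intro I.coeffs_in_ideal_mult coeffs_in_intros power_mem)
        ultimately have "- (lead_coeff m ^ k) \<in> I"
          using I.constant_in_ideal[OF m(1) degm e'(2,1) qr(1), of "- (lead_coeff m ^ k)"] lcA
          by (simp add: power_mem uminus_mem)
        then have "lead_coeff m ^ k \<in> I" using I.ideal_uminus by fastforce
        then show False using I.unit_power_notin[OF lcA e'(2,1)] by blast
      qed
    qed
    moreover have "d * (poly g a * lead_coeff m * e) - 1 \<in> J"
      using I(3) IJ by (auto simp: c_def mult_ac)
    moreover have "poly g a * lead_coeff m * e \<in> adjoin A a"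
      using polyB g(1) AB lcA I(2) by (intro B.mult_mem) auto
    ultimately show ?thesis by blast
  next
    case False
    then have transc: "g = 0" if "g \<in> coeffs_in A" "poly g a = 0" for g using that by blast
    define c where "c = lead_coeff f"
    have f0: "f \<noteq> 0" using d f by auto
    have "c \<in> A" "c \<noteq> 0" using f(1) f0 by (auto simp: c_def intro: coeffs_inD)
    then obtain I e where I: "finite_index_ideal A I" "e \<in> A" "c * e - 1 \<in> I"
      using A unfolding residually_finite_ring_def by blast
    interpret I: finite_index_ideal A I by fact
    define m where "m = pCons (-1) f"
    have m: "m \<in> coeffs_in A" "degree m > 0" "lead_coeff m = c"
      using f(1) f0 by (auto simp: m_def c_def intro!: coeffs_in_intros uminus_mem one_mem)
    define J where "J = {poly (g + m * h) a |g h. g \<in> coeffs_in I \<and> h \<in> coeffs_in A}"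
    have JI: "poly (g + m * h) a \<in> J" if "g \<in> coeffs_in I" "h \<in> coeffs_in A" for g h
      using that unfolding J_def by blast
    have I0: "0 \<in> coeffs_in I" by (simp add: coeffs_in_def I.ideal_zero)
    have IJ: "I \<subseteq> J" using JI[OF I.coeffs_in_ideal_const coeffs_in_zero] by auto
    have mJ: "poly m a \<in> J" using JI[OF I0 coeffs_in_one] by simp
    have "finite_index_ideal (adjoin A a) J"
    proof (rule I.finite_index_ideal_adjoin[OF IJ _ _ _ _ m(1,2) mJ _ I(2)])
      show "lead_coeff m * e - 1 \<in> I" using I(3) m(3) by simp
      show "J \<subseteq> adjoin A a"
        unfolding J_def using I.coeffs_in_ideal_subset m(1) by (auto simp del: poly_add poly_mult intro!: polyB coeffs_in_intros)
      show "x - y \<in> J" if xy: "x \<in> J" "y \<in> J" for x y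
      proof -
        obtain g h g' h' where *: "x = poly (g + m * h) a" "y = poly (g' + m * h') a"
          "g \<in> coeffs_in I" "g' \<in> coeffs_in I" "h \<in> coeffs_in A" "h' \<in> coeffs_in A"
          using xy unfolding J_def by blast
        have "x - y = poly ((g - g') + m * (h - h')) a" by (simp add: * algebra_simps)
        then show ?thesis using * by (simp only: JI I.coeffs_in_ideal_diff coeffs_in_diff)
      qed
      show "x * y \<in> J" if xy: "x \<in> adjoin A a" "y \<in> J" for x y
      proof -
        obtain g h where *: "y = poly (g + m * h) a" "g \<in> coeffs_in I" "h \<in> coeffs_in A"
          using xy unfolding J_def by blast
        obtain w where w: "x = poly w a" "w \<in> coeffs_in A" using xy unfolding adjoin_def by blast
        have "x * y = poly (w * g + m * (w * h)) a" by (simp add: * w algebra_simps)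
        then show ?thesis using * w(2) by (simp only: JI I.coeffs_in_ideal_mult coeffs_in_mult)
      qed
      show "1 \<notin> J"
      proof
        assume "1 \<in> J"
        then obtain g h where gh: "poly (g + m * h) a = 1" "g \<in> coeffs_in I" "h \<in> coeffs_in A"
          unfolding J_def by auto
        have "g + m * h - 1 = 0"
          using gh m(1) I.coeffs_in_ideal_subset by (intro transc coeffs_in_intros) auto
        then have "h * m - [:1:] = 0 - g" by (simp add: algebra_simps one_pCons)
        moreover have "0 - g \<in> coeffs_in I" using I0 gh(2) by (rule I.coeffs_in_ideal_diff)
        ultimately have "1 \<in> I"
          using I.constant_in_ideal[OF m(1,2) _ I(2) gh(3) one_mem] I(3) m(3) by simp
        then show False using I.proper by blast
      qed
    qed
    moreover have "d * a - 1 \<in> J" using mJ by (simp add: m_def f(2) mult.commute)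
    ultimately show ?thesis using mem_adjoin by blast
  qed
qed

lemma residually_finite_ring_containing:
  fixes X :: "'a::field_char_0 set"
  assumes "finite X"
  shows "\<exists>A. unital_subring A \<and> residually_finite_ring A \<and> X \<subseteq> A"
  using assms
proof (induction X rule: finite_induct)
  case empty
  have "unital_subring (\<int> :: 'a set)" by unfold_locales auto
  then show ?case using residually_finite_ring_Ints by blast
next
  case (insert a X)
  then obtain A where A: "unital_subring A" "residually_finite_ring A" "X \<subseteq> A" by blast
  interpret unital_subring A by fact
  show ?case using unital_subring_adjoin residually_finite_ring_adjoin[OF A(2)] subset_adjoin mem_adjoin A(3)
    by (intro exI[of _ "adjoin A a"]) blast
qed

section \<open>Unit quaternions\<close>

type_synonym quat = "complex \<times> complex"

text \<open>The pair \<open>(a, b)\<close> stands for the quaternion \<open>a + b j\<close>.\<close>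

definition qmul :: "quat \<Rightarrow> quat \<Rightarrow> quat" where
  "qmul x y = (fst x * fst y - snd x * cnj (snd y), fst x * snd y + snd x * cnj (fst y))"

definition qconj :: "quat \<Rightarrow> quat" where
  "qconj x = (cnj (fst x), - snd x)"

definition qnorm :: "quat \<Rightarrow> real" where
  "qnorm x = (cmod (fst x))\<^sup>2 + (cmod (snd x))\<^sup>2"

definition quat_over :: "real set \<Rightarrow> quat set" where
  "quat_over A = {x. Re (fst x) \<in> A \<and> Im (fst x) \<in> A \<and> Re (snd x) \<in> A \<and> Im (snd x) \<in> A}"

definition unit_quat :: "real set \<Rightarrow> quat monoid" where
  "unit_quat A = \<lparr>carrier = {x \<in> quat_over A. qnorm x = 1}, monoid.mult = qmul, one = (1, 0)\<rparr>"

lemma unit_quat_simps [simp]: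
  "carrier (unit_quat A) = {x \<in> quat_over A. qnorm x = 1}"
  "monoid.mult (unit_quat A) = qmul"
  "one (unit_quat A) = (1, 0)"
  by (simp_all add: unit_quat_def)

lemma quat_over_UNIV [simp]: "quat_over UNIV = UNIV"
  by (simp add: quat_over_def)

lemma qmul_assoc: "qmul (qmul x y) z = qmul x (qmul y z)"
  by (simp add: qmul_def algebra_simps)

lemma qmul_one [simp]: "qmul (1, 0) x = x" "qmul x (1, 0) = x"
  by (simp_all add: qmul_def)

lemma qmul_diff_left: "qmul (x - y) z = qmul x z - qmul y z"
  by (simp add: qmul_def algebra_simps)

lemma qmul_diff_right: "qmul x (y - z) = qmul x y - qmul x z"
  by (simp add: qmul_def algebra_simps)

lemma qmul_uminus [simp]: "qmul x (- y) = - qmul x y" "qmul (- x) y = - qmul x y"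
  by (simp_all add: qmul_def)

lemma qnorm_qmul: "qnorm (qmul x y) = qnorm x * qnorm y"
  unfolding qnorm_def cmod_power2 by (simp add: qmul_def power2_eq_square algebra_simps)

lemma qnorm_qconj: "qnorm (qconj x) = qnorm x"
  by (simp add: qnorm_def qconj_def)

lemma qnorm_eq_one: "qnorm x = 1 \<longleftrightarrow> (Re (fst x))\<^sup>2 + (Im (fst x))\<^sup>2 + (Re (snd x))\<^sup>2 + (Im (snd x))\<^sup>2 = 1"
  by (simp add: qnorm_def cmod_power2 add.assoc)

lemma qconj_qmul: "qnorm x = 1 \<Longrightarrow> qmul (qconj x) x = (1, 0)"
  unfolding qnorm_eq_one qmul_def qconj_def
  by (simp add: complex_eq_iff power2_eq_square algebra_simps)

lemma quat_over_qmul: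
  assumes A: "unital_subring A" and "x \<in> quat_over A" "y \<in> quat_over A"
  shows "qmul x y \<in> quat_over A"
proof -
  interpret unital_subring A by fact
  show ?thesis using assms(2,3) by (auto simp: quat_over_def qmul_def intro!: add_mem diff_mem mult_mem)
qed

lemma group_unit_quat:
  assumes A: "unital_subring A" shows "group (unit_quat A)"
proof (rule groupI)
  interpret unital_subring A by fact
  show "\<one>\<^bsub>unit_quat A\<^esub> \<in> carrier (unit_quat A)"
    by (simp add: quat_over_def qnorm_def one_mem zero_mem)
  fix x assume x: "x \<in> carrier (unit_quat A)"
  then show "\<exists>y\<in>carrier (unit_quat A). y \<otimes>\<^bsub>unit_quat A\<^esub> x = \<one>\<^bsub>unit_quat A\<^esub>"
    by (intro bexI[of _ "qconj x"]) (auto simp: qconj_qmul qnorm_qconj, auto simp: quat_over_def qconj_def uminus_mem)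
qed (auto simp: quat_over_qmul[OF A] qnorm_qmul qmul_assoc)

lemma unital_subring_UNIV: "unital_subring UNIV"
  by unfold_locales auto

abbreviation S3 where "S3 \<equiv> unit_quat UNIV"

interpretation S3: group S3 by (rule group_unit_quat[OF unital_subring_UNIV])

lemma inv_S3: "qnorm x = 1 \<Longrightarrow> inv\<^bsub>S3\<^esub> x = qconj x"
  by (rule S3.inv_equality) (simp_all add: qconj_qmul qnorm_qconj)

lemma unit_quat_hom_S3: "unital_subring A \<Longrightarrow> group_hom (unit_quat A) S3 id"
  by (rule group_homI) (auto simp: group_unit_quat hom_def S3.is_group)

section \<open>Finite quotients of groups of quaternions\<close>

text \<open>The quaternions congruent to \<open>1\<close> or \<open>- 1\<close>. Both signs are needed, since the generators
  satisfy the relators only up to sign: rotations have two quaternion lifts each.\<close>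

definition sign_congruence_kernel :: "real set \<Rightarrow> real set \<Rightarrow> quat set" where
  "sign_congruence_kernel A I = {x \<in> carrier (unit_quat A). \<exists>s\<in>{(1, 0), (-1, 0)}. x - s \<in> quat_over I}"

lemma finite_image_factor:
  assumes "finite (g ` X)" "\<And>x y. \<lbrakk>x \<in> X; y \<in> X; g x = g y\<rbrakk> \<Longrightarrow> f x = f y"
  shows "finite (f ` X)"
proof (rule finite_subset)
  show "f ` X \<subseteq> (\<lambda>t. f (SOME x. x \<in> X \<and> g x = t)) ` g ` X"
  proof
    fix z assume "z \<in> f ` X"
    then obtain x where x: "x \<in> X" "z = f x" by blast
    define y where "y = (SOME y. y \<in> X \<and> g y = g x)"
    have "y \<in> X \<and> g y = g x" unfolding y_def by (rule someI[of _ x]) (simp add: x)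
    then have "f y = f x" using x assms(2) by blast
    then have "z = f (SOME y. y \<in> X \<and> g y = g x)" unfolding y_def x(2) by (rule HOL.sym)
    then show "z \<in> (\<lambda>t. f (SOME x. x \<in> X \<and> g x = t)) ` g ` X" using x(1) by (rule image_eqI[OF _ imageI])
  qed
qed (use assms(1) in simp)

context
  fixes A I :: "real set"
  assumes ideal: "finite_index_ideal A I"
begin

interpretation finite_index_ideal A I by (rule ideal)
interpretation A: group "unit_quat A" by (rule group_unit_quat[OF unital_subring_axioms])

lemma quat_over_ideal_qmul:
  assumes "x \<in> quat_over A" "y \<in> quat_over I"
  shows "qmul x y \<in> quat_over I" "qmul y x \<in> quat_over I"
  using assms by (simp_all add: quat_over_def qmul_def ideal_add ideal_diff ideal_mult ideal_mult')

lemma quat_over_ideal_diff: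
  "\<lbrakk>x \<in> quat_over I; y \<in> quat_over I\<rbrakk> \<Longrightarrow> x - y \<in> quat_over I"
  by (auto simp: quat_over_def ideal_diff)

lemma quat_over_ideal_uminus: "x \<in> quat_over I \<Longrightarrow> - x \<in> quat_over I"
  by (auto simp: quat_over_def ideal_uminus)

lemma quat_over_ideal_qconj: "x \<in> quat_over I \<Longrightarrow> qconj x \<in> quat_over I"
  by (auto simp: quat_over_def qconj_def ideal_uminus)

lemma unit_sign: "s \<in> {(1, 0), (-1, 0)} \<Longrightarrow> s \<in> quat_over A"
  by (auto simp: quat_over_def one_mem zero_mem uminus_mem)

text \<open>The quaternions with coordinates in \<open>I\<close> form a two-sided ideal of those with coordinates in \<open>A\<close>,
  and \<open>\<plusminus> 1\<close> is central.\<close>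

lemma sign_congruence_kernel_normal: "sign_congruence_kernel A I \<lhd> unit_quat A"
  unfolding A.normal_inv_iff
proof (intro conjI ballI)
  let ?N = "sign_congruence_kernel A I"
  have inv: "inv\<^bsub>unit_quat A\<^esub> x = qconj x" if "x \<in> carrier (unit_quat A)" for x
    using that by (intro A.inv_equality)
      (auto simp: qconj_qmul qnorm_qconj, auto simp: quat_over_def qconj_def uminus_mem)
  show "subgroup ?N (unit_quat A)"
  proof (rule A.subgroupI)
    show "?N \<subseteq> carrier (unit_quat A)" by (auto simp: sign_congruence_kernel_def)
    have "(1, 0) \<in> ?N"
      using A.one_closed by (auto simp: sign_congruence_kernel_def quat_over_def ideal_zero)
    then show "?N \<noteq> {}" by blast
    fix x assume x: "x \<in> ?N"
    then obtain s where s: "s \<in> {(1, 0), (-1, 0)}" "x - s \<in> quat_over I" and xA: "x \<in> carrier (unit_quat A)"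
      by (auto simp: sign_congruence_kernel_def)
    have "qconj x - s = qconj (x - s)" using s(1) by (auto simp: qconj_def prod_eq_iff)
    moreover have "qconj (x - s) \<in> quat_over I" by (rule quat_over_ideal_qconj[OF s(2)])
    ultimately show "inv\<^bsub>unit_quat A\<^esub> x \<in> ?N"
      using A.inv_closed[OF xA] s(1) unfolding inv[OF xA] sign_congruence_kernel_def by auto
    fix y assume y: "y \<in> ?N"
    then obtain t where t: "t \<in> {(1, 0), (-1, 0)}" "y - t \<in> quat_over I" and yA: "y \<in> carrier (unit_quat A)"
      by (auto simp: sign_congruence_kernel_def)
    have "qmul x y - qmul s t = qmul (x - s) y - qmul s (t - y)"
      by (simp add: qmul_diff_left qmul_diff_right)
    also have "\<dots> \<in> quat_over I"
    proof (rule quat_over_ideal_diff[OF quat_over_ideal_qmul(2)[OF _ s(2)] quat_over_ideal_qmul(1)[OF unit_sign[OF s(1)]]])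
      show "y \<in> quat_over A" using yA by simp
      show "t - y \<in> quat_over I" using quat_over_ideal_uminus[OF t(2)] by simp
    qed
    finally have "qmul x y - qmul s t \<in> quat_over I" .
    moreover have "qmul s t \<in> {(1, 0), (-1, 0)}" using s(1) t(1) by (auto simp: qmul_def)
    ultimately show "x \<otimes>\<^bsub>unit_quat A\<^esub> y \<in> ?N"
      using A.m_closed[OF xA yA] unfolding sign_congruence_kernel_def by auto
  qed
  fix g x assume g: "g \<in> carrier (unit_quat A)" and x: "x \<in> ?N"
  then obtain s where s: "s \<in> {(1, 0), (-1, 0)}" "x - s \<in> quat_over I" and xA: "x \<in> carrier (unit_quat A)"
    by (auto simp: sign_congruence_kernel_def)
  have gi: "inv\<^bsub>unit_quat A\<^esub> g \<in> carrier (unit_quat A)" using g by (rule A.inv_closed)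
  have ginv: "qmul g (inv\<^bsub>unit_quat A\<^esub> g) = (1, 0)" using A.r_inv[OF g] by simp
  consider "s = (1, 0)" | "s = - (1, 0)" using s(1) by auto
  then have "qmul (qmul g s) (inv\<^bsub>unit_quat A\<^esub> g) = s"
    by cases (simp_all only: qmul_uminus qmul_one ginv)
  then have "qmul (qmul g x) (inv\<^bsub>unit_quat A\<^esub> g) - s = qmul (qmul g (x - s)) (inv\<^bsub>unit_quat A\<^esub> g)"
    by (simp add: qmul_diff_left qmul_diff_right)
  also have "\<dots> \<in> quat_over I"
    by (rule quat_over_ideal_qmul(2)[OF _ quat_over_ideal_qmul(1)[OF _ s(2)]]) (use g gi in simp_all)
  finally show "g \<otimes>\<^bsub>unit_quat A\<^esub> x \<otimes>\<^bsub>unit_quat A\<^esub> inv\<^bsub>unit_quat A\<^esub> g \<in> ?N"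
    using A.m_closed[OF A.m_closed[OF g xA] gi] s(1) unfolding sign_congruence_kernel_def by auto
qed

text \<open>A coset is determined by the residues modulo \<open>I\<close> of the four coordinates of a representative.\<close>

lemma finite_sign_congruence_quotient: "finite (carrier (unit_quat A Mod sign_congruence_kernel A I))"
proof -
  let ?N = "sign_congruence_kernel A I"
  interpret N: normal ?N "unit_quat A" by (rule sign_congruence_kernel_normal)
  obtain S where S: "finite S" "S \<subseteq> A" "\<And>x. x \<in> A \<Longrightarrow> \<exists>s\<in>S. x - s \<in> I" using finite_index by blast
  then have "\<forall>x\<in>A. \<exists>s. s \<in> S \<and> x - s \<in> I" by blast
  from bchoice[OF this] obtain \<rho> where \<rho>: "\<And>x. x \<in> A \<Longrightarrow> \<rho> x \<in> S \<and> x - \<rho> x \<in> I" by blast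
  have cong: "x - y \<in> I" if "x \<in> A" "y \<in> A" "\<rho> x = \<rho> y" for x y
    using ideal_diff[OF conjunct2[OF \<rho>[OF that(1)]] conjunct2[OF \<rho>[OF that(2)]]] that(3) by simp
  define g where "g x = (\<rho> (Re (fst x)), \<rho> (Im (fst x)), \<rho> (Re (snd x)), \<rho> (Im (snd x)))" for x :: quat
  have "g ` carrier (unit_quat A) \<subseteq> S \<times> S \<times> S \<times> S"
    using \<rho> by (auto simp: g_def quat_over_def)
  then have fin: "finite (g ` carrier (unit_quat A))" by (rule finite_subset) (use S(1) in blast)
  have "finite ((\<lambda>x. ?N #>\<^bsub>unit_quat A\<^esub> x) ` carrier (unit_quat A))"
  proof (rule finite_image_factor[OF fin])
    fix x y assume x: "x \<in> carrier (unit_quat A)" and y: "y \<in> carrier (unit_quat A)" and gxy: "g x = g y"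
    have xy: "x - y \<in> quat_over I"
      using x y gxy cong by (auto simp: g_def quat_over_def)
    let ?i = "inv\<^bsub>unit_quat A\<^esub> y"
    have i: "?i \<in> carrier (unit_quat A)" using y by (rule A.inv_closed)
    have "qmul x ?i - (1, 0) = qmul (x - y) ?i"
      using A.r_inv[OF y] by (simp add: qmul_diff_left)
    also have "\<dots> \<in> quat_over I" by (rule quat_over_ideal_qmul(2)[OF _ xy]) (use i in simp)
    finally have "x \<otimes>\<^bsub>unit_quat A\<^esub> ?i \<in> ?N"
      using A.m_closed[OF x i] unfolding sign_congruence_kernel_def by auto
    then have "x \<in> ?N #>\<^bsub>unit_quat A\<^esub> y"
      using N.rcos_module[OF A.is_group y x] by blast
    then show "?N #>\<^bsub>unit_quat A\<^esub> x = ?N #>\<^bsub>unit_quat A\<^esub> y"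
      by (rule A.repr_independence[OF _ y N.is_subgroup, symmetric])
  qed
  moreover have "carrier (unit_quat A Mod ?N) = (\<lambda>x. ?N #>\<^bsub>unit_quat A\<^esub> x) ` carrier (unit_quat A)"
    by (auto simp: FactGroup_def RCOSETS_def)
  ultimately show ?thesis by simp
qed

end

text \<open>Three unit quaternions that satisfy the relators and the equation \<open>u = 1\<close> up to sign
  give a finite quotient. A nonzero imaginary coordinate \<open>d\<close> of a generator other than \<open>\<plusminus> 1\<close> shows that
  this generator survives modulo any ideal that avoids \<open>d\<close>.\<close>

lemma finitely_annihilated_of_quaternions:
  assumes e: "\<And>x. qnorm (e x) = 1"
    and ord: "\<And>x. e x [^]\<^bsub>S3\<^esub> gen_order p q r x \<in> {(1, 0), (-1, 0)}"
    and u: "word_eval S3 e u \<in> {(1, 0), (-1, 0)}" and nontriv: "e x \<notin> {(1, 0), (-1, 0)}"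
  shows "finitely_annihilated_element (group_K p q r) (K_class p q r u)"
proof -
  define C where "C x = {Re (fst x), Im (fst x), Re (snd x), Im (snd x)}" for x :: quat
  have fin: "finite (C (e Gen_x) \<union> C (e Gen_y) \<union> C (e Gen_z))" by (simp add: C_def)
  obtain A where A: "unital_subring A" "residually_finite_ring A"
    and CA: "C (e Gen_x) \<union> C (e Gen_y) \<union> C (e Gen_z) \<subseteq> A"
    using residually_finite_ring_containing[OF fin] by (elim exE conjE)
  interpret unital_subring A by fact
  interpret A: group "unit_quat A" by (rule group_unit_quat[OF A(1)])
  interpret i: group_hom "unit_quat A" S3 id by (rule unit_quat_hom_S3[OF A(1)])
  have eA: "e x \<in> carrier (unit_quat A)" for x
  proof -
    have "C (e x) \<subseteq> A" using CA by (cases x) simp_all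
    then show ?thesis using e[of x] by (simp add: quat_over_def C_def)
  qed
  then have eA': "range e \<subseteq> carrier (unit_quat A)" by blast
  have "\<exists>d. d \<in> {Im (fst (e x)), Re (snd (e x)), Im (snd (e x))} \<and> d \<noteq> 0"
  proof (rule ccontr)
    assume "\<not> ?thesis"
    then have 0: "Im (fst (e x)) = 0" "Re (snd (e x)) = 0" "Im (snd (e x)) = 0" by auto
    then have "Re (fst (e x)) = 1 \<or> Re (fst (e x)) = -1"
      using e[of x] by (simp add: qnorm_eq_one power2_eq_1_iff)
    then have "e x = (1, 0) \<or> e x = (-1, 0)" using 0 by (simp add: prod_eq_iff complex_eq_iff)
    then show False using nontriv by simp
  qed
  then obtain d where d: "d \<in> {Im (fst (e x)), Re (snd (e x)), Im (snd (e x))}" "d \<noteq> 0" by blast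
  have "d \<in> A" using d(1) eA[of x] by (auto simp: quat_over_def)
  then obtain I c where I: "finite_index_ideal A I" "c \<in> A" "d * c - 1 \<in> I"
    using A(2) d(2) unfolding residually_finite_ring_def by blast
  interpret finite_index_ideal A I by fact
  have dI: "d \<notin> I"
    using unit_power_notin[OF \<open>d \<in> A\<close> I(3,2), of 1] by simp
  let ?N = "sign_congruence_kernel A I"
  interpret N: normal ?N "unit_quat A" by (rule sign_congruence_kernel_normal[OF I(1)])
  let ?H = "unit_quat A Mod ?N" and ?\<pi> = "\<lambda>x. ?N #>\<^bsub>unit_quat A\<^esub> x"
  interpret H: group ?H by (rule N.factorgroup_is_group)
  interpret \<pi>: group_hom "unit_quat A" ?H ?\<pi> by (rule group_homI[OF A.is_group H.is_group N.r_coset_hom_Mod])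
  have \<pi>_one: "?\<pi> y = \<one>\<^bsub>?H\<^esub>" if "y \<in> {(1, 0), (-1, 0)}" "y \<in> carrier (unit_quat A)" for y
  proof -
    have "y - y \<in> quat_over I" by (simp add: quat_over_def ideal_zero)
    then have "y \<in> ?N" using that unfolding sign_congruence_kernel_def by blast
    then show ?thesis unfolding FactGroup_def by (simp only: monoid.select_convs N.rcos_const[OF A.is_group])
  qed
  have "\<exists>\<phi>\<in>hom (group_K p q r) ?H. \<forall>u. \<phi> (K_class p q r u) = word_eval ?H (?\<pi> \<circ> e) u"
  proof (rule group_K_universal[OF H.is_group])
    show "range (?\<pi> \<circ> e) \<subseteq> carrier ?H" using \<pi>.hom_closed[OF eA] by auto
    fix x
    have "e x [^]\<^bsub>unit_quat A\<^esub> gen_order p q r x = e x [^]\<^bsub>S3\<^esub> gen_order p q r x"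
      using i.hom_nat_pow[OF eA] by simp
    then have "?\<pi> (e x [^]\<^bsub>unit_quat A\<^esub> gen_order p q r x) = \<one>\<^bsub>?H\<^esub>"
      using ord[of x] A.nat_pow_closed[OF eA] by (intro \<pi>_one) metis+
    then show "(?\<pi> \<circ> e) x [^]\<^bsub>?H\<^esub> gen_order p q r x = \<one>\<^bsub>?H\<^esub>"
      using \<pi>.hom_nat_pow[OF eA] by simp
  qed
  then obtain \<phi> where \<phi>: "\<phi> \<in> hom (group_K p q r) ?H"
    "\<And>u. \<phi> (K_class p q r u) = word_eval ?H (?\<pi> \<circ> e) u" by blast
  have "word_eval (unit_quat A) e u = word_eval S3 e u"
    using i.hom_word_eval[OF eA', of u] by simp
  then have "?\<pi> (word_eval (unit_quat A) e u) = \<one>\<^bsub>?H\<^esub>"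
    using u A.word_eval_closed[OF eA'] by (intro \<pi>_one) metis+
  then have 1: "\<phi> (K_class p q r u) = \<one>\<^bsub>?H\<^esub>"
    unfolding \<phi>(2) using \<pi>.hom_word_eval[OF eA', of u] by simp
  have "e x \<notin> ?N"
  proof
    assume "e x \<in> ?N"
    then obtain s where "s \<in> {(1, 0), (-1, 0)}" "e x - s \<in> quat_over I"
      by (auto simp: sign_congruence_kernel_def)
    then have "Im (fst (e x)) \<in> I" "Re (snd (e x)) \<in> I" "Im (snd (e x)) \<in> I"
      by (auto simp: quat_over_def)
    then show False using d(1) dI by auto
  qed
  then have "?\<pi> (e x) \<noteq> \<one>\<^bsub>?H\<^esub>"
    using A.coset_join1[OF _ eA N.is_subgroup] by (auto simp: FactGroup_def)
  moreover have "\<phi> (K_gen p q r x) = ?\<pi> (e x)"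
    using \<pi>.hom_closed[OF eA, of x] unfolding \<phi>(2) word_eval.simps by (simp only: fst_conv snd_conv if_True o_def H.r_one)
  moreover have "K_gen p q r x \<in> carrier (group_K p q r)" "K_class p q r u \<in> carrier (group_K p q r)"
    unfolding carrier_group_K by (rule rangeI)+
  ultimately have 2: "\<phi> ` carrier (group_K p q r) \<noteq> {\<one>\<^bsub>?H\<^esub>}"
    by (metis imageI singletonD)
  show ?thesis
    by (rule finitely_annihilated_elementI[OF group_group_K H.is_group finite_sign_congruence_quotient[OF I(1)]
        \<phi>(1) \<open>K_class p q r u \<in> _\<close> 1 2])
qed

section \<open>A quaternionic solution of the equation\<close>

text \<open>The quaternion \<open>cos t + v sin t\<close>, with \<open>v\<close> on the sphere regarded as an imaginary
  unit. It acts on 3-space as the rotation about \<open>v\<close> by the angle \<open>2 t\<close>.\<close>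

definition rot :: "real \<Rightarrow> real \<times> complex \<Rightarrow> quat" where
  "rot t v = (Complex (cos t) (fst v * sin t), of_real (sin t) * snd v)"

lemma qnorm_rot: "v \<in> S2 \<Longrightarrow> qnorm (rot t v) = 1"
proof -
  assume v: "v \<in> S2"
  have "qnorm (rot t v) = (cos t)\<^sup>2 + (sin t)\<^sup>2 * ((fst v)\<^sup>2 + (cmod (snd v))\<^sup>2)"
    by (simp add: qnorm_def rot_def cmod_power2 norm_mult power_mult_distrib algebra_simps)
  then show ?thesis using v by (simp add: S2_iff)
qed

lemma qmul_rot: 
  assumes v: "v \<in> S2" shows "qmul (rot s v) (rot t v) = rot (s + t) v"
proof -
  have "(fst v)\<^sup>2 + (Re (snd v))\<^sup>2 + (Im (snd v))\<^sup>2 = 1"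
    using v unfolding S2_iff cmod_power2 by (simp add: add.assoc)
  then have *: "sin s * sin t * ((fst v)\<^sup>2 + (Re (snd v))\<^sup>2 + (Im (snd v))\<^sup>2) = sin s * sin t" by simp
  have "Re (fst (qmul (rot s v) (rot t v))) =
      cos s * cos t - sin s * sin t * ((fst v)\<^sup>2 + (Re (snd v))\<^sup>2 + (Im (snd v))\<^sup>2)"
    by (simp add: qmul_def rot_def power2_eq_square algebra_simps)
  also have "\<dots> = Re (fst (rot (s + t) v))" unfolding * by (simp add: rot_def cos_add)
  finally show ?thesis
    by (auto simp: prod_eq_iff complex_eq_iff) (simp_all add: qmul_def rot_def sin_add algebra_simps)
qed

lemma pow_rot: "v \<in> S2 \<Longrightarrow> rot t v [^]\<^bsub>S3\<^esub> (n::nat) = rot (real n * t) v"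
proof (induction n)
  case (Suc n)
  then show ?case by (simp add: qmul_rot algebra_simps)
qed (simp add: rot_def complex_eq_iff)

lemma rot_sign: "sin t = 0 \<Longrightarrow> rot t v \<in> {(1, 0), (-1, 0)}"
  using sin_zero_abs_cos_one[of t] by (auto simp: rot_def complex_eq_iff abs_if split: if_splits)

lemma rot_not_sign: "\<lbrakk>v \<in> S2; sin t \<noteq> 0\<rbrakk> \<Longrightarrow> rot t v \<notin> {(1, 0), (-1, 0)}"
  by (auto simp: rot_def complex_eq_iff S2_iff cmod_power2)

lemma rot_poles: "rot t (1, 0) = (cis t, 0)" "rot t (-1, 0) = (cis (- t), 0)"
  by (simp_all add: rot_def complex_eq_iff)

lemma word_eval_cis:
  fixes t :: "xyz \<Rightarrow> real"
  shows "word_eval S3 (\<lambda>x. (cis (t x), 0)) u =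
    (cis (exponent_sum Gen_x u * t Gen_x + exponent_sum Gen_y u * t Gen_y + exponent_sum Gen_z u * t Gen_z), 0)"
proof (induction u)
  case (Cons l u)
  have inv: "inv\<^bsub>S3\<^esub> (cis s, 0) = (cis (- s), 0)" for s
    by (simp add: inv_S3 qnorm_def qconj_def cis_cnj)
  obtain x b where l: "l = (x, b)" by force
  show ?case
    by (cases x; cases b) (simp_all add: Cons.IH l inv qmul_def cis_mult algebra_simps)
qed simp

lemma continuous_on_word_eval:
  fixes e :: "'c::topological_space \<Rightarrow> 'x \<Rightarrow> quat"
  assumes "\<And>x. continuous_on T (\<lambda>y. e y x)" and "\<And>y x. y \<in> T \<Longrightarrow> qnorm (e y x) = 1"
  shows "continuous_on T (\<lambda>y. word_eval S3 (e y) u)"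
proof (induction u)
  case (Cons l u)
  have mul: "continuous_on T (\<lambda>y. qmul (f y) (g y))" if "continuous_on T f" "continuous_on T g" for f g
    unfolding qmul_def using that by (intro continuous_intros)
  have "continuous_on T (\<lambda>y. if snd l then e y (fst l) else inv\<^bsub>S3\<^esub> e y (fst l))"
  proof (cases "snd l")
    case False
    have "continuous_on T (\<lambda>y. qconj (e y (fst l)))"
      unfolding qconj_def using assms(1) by (intro continuous_intros)
    then have "continuous_on T (\<lambda>y. inv\<^bsub>S3\<^esub> e y (fst l))"
      by (rule continuous_on_eq) (simp add: inv_S3 assms(2))
    then show ?thesis using False by simp
  qed (use assms(1) in simp)
  then show ?case using Cons.IH by (simp add: mul)
qed simp

definition quat_imag :: "quat \<Rightarrow> real \<times> complex" where
  "quat_imag x = (Im (fst x), snd x)"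

lemma quat_imag_eq_0: "\<lbrakk>qnorm x = 1; quat_imag x = 0\<rbrakk> \<Longrightarrow> x \<in> {(1, 0), (-1, 0)}"
  by (auto simp: quat_imag_def qnorm_eq_one zero_prod_def power2_eq_1_iff prod_eq_iff complex_eq_iff)

text \<open>Conjugation by a square root of the unit complex number \<open>c\<close>, that is, rotation about the axis.\<close>

definition phase :: "complex \<Rightarrow> quat \<Rightarrow> quat" where
  "phase c x = (fst x, c * snd x)"

lemma group_hom_phase: "cmod c = 1 \<Longrightarrow> group_hom S3 S3 (phase c)"
proof (rule group_homI[OF S3.is_group S3.is_group])
  assume c: "cmod c = 1"
  then have cc: "c * cnj c = 1" by (simp add: complex_norm_square[symmetric])
  have "c * a * (cnj c * b) = a * b" for a b using cc by (metis mult.assoc mult.commute mult.left_neutral)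
  then show "phase c \<in> hom S3 S3"
    using c by (auto simp: hom_def phase_def qmul_def qnorm_def norm_mult algebra_simps)
qed

lemma sgn_quat_imag_phase: "cmod c = 1 \<Longrightarrow> sgn (quat_imag (phase c x)) = (fst (sgn (quat_imag x)), c * snd (sgn (quat_imag x)))"
  by (simp add: sgn_prod_def quat_imag_def phase_def norm_prod_def norm_mult)

definition rot_gens :: "real \<Rightarrow> real \<Rightarrow> real \<Rightarrow> real \<Rightarrow> real \<times> complex \<Rightarrow> xyz \<Rightarrow> quat" where
  "rot_gens a b c \<theta> v x = (case x of Gen_x \<Rightarrow> rot a (1, 0) | Gen_y \<Rightarrow> rot b (cos \<theta>, of_real (sin \<theta>)) | Gen_z \<Rightarrow> rot c v)"

lemma cos_sin_S2: "(cos \<theta>, of_real (sin \<theta>)) \<in> S2"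
  by (simp add: in_S2)

lemma qnorm_rot_gens: "v \<in> S2 \<Longrightarrow> qnorm (rot_gens a b c \<theta> v x) = 1"
  by (cases x) (simp_all add: rot_gens_def qnorm_rot cos_sin_S2 in_S2)

text \<open>Suppose that there is no solution. Then the normalised imaginary part \<open>F \<theta>\<close> of the value of \<open>u\<close> is a
  homotopy between the axial maps \<open>F 0\<close> and \<open>F \<pi>\<close>. At the pole \<open>(\<zeta>, 0)\<close> all three generators are
  complex numbers \<open>cis\<close>, with \<open>b\<close> negated for \<open>\<theta> = \<pi>\<close> and \<open>c\<close> negated for \<open>\<zeta> = - 1\<close>, so the
  sign of \<open>f\<close> decides to which pole it is mapped. For \<open>\<delta> > 0\<close> the sign conditions say that \<open>F 0\<close>
  exchanges the poles and \<open>F \<pi>\<close> fixes them; for \<open>\<delta> < 0\<close> the roles are reversed.\<close>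

lemma quaternion_solution:
  fixes u :: "(xyz \<times> bool) list" and a b c :: real
  defines "f \<equiv> \<lambda>\<eta> \<zeta>. sin (exponent_sum Gen_x u * a + \<eta> * (exponent_sum Gen_y u * b) + \<zeta> * (exponent_sum Gen_z u * c))"
  assumes \<delta>: "\<delta> * f 1 1 < 0" "\<delta> * f 1 (-1) > 0" "\<delta> * f (-1) 1 > 0" "\<delta> * f (-1) (-1) < 0"
  shows "\<exists>\<theta>. \<exists>v\<in>S2. word_eval S3 (rot_gens a b c \<theta> v) u \<in> {(1, 0), (-1, 0)}"
proof (rule ccontr)
  assume no: "\<not> ?thesis"
  define W where "W \<theta> v = word_eval S3 (rot_gens a b c \<theta> v) u" for \<theta> v
  define F where "F \<theta> v = sgn (quat_imag (W \<theta> v))" for \<theta> v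
  have gU: "range (rot_gens a b c \<theta> v) \<subseteq> carrier S3" if "v \<in> S2" for \<theta> v
    using qnorm_rot_gens[OF that] by auto
  have W1: "qnorm (W \<theta> v) = 1" if "v \<in> S2" for \<theta> v
    using S3.word_eval_closed[OF gU[OF that]] by (simp add: W_def)
  have nz: "quat_imag (W \<theta> v) \<noteq> 0" if "v \<in> S2" for \<theta> v
    using no quat_imag_eq_0[OF W1[OF that]] that unfolding W_def by blast
  have rot_c: "continuous_on T (\<lambda>y. rot t (h y))" if "continuous_on T h" for T :: "(real \<times> real \<times> complex) set" and t h
    unfolding rot_def Complex_eq using that by (intro continuous_intros)
  have Wc: "continuous_on ({0..1} \<times> S2) (\<lambda>y. W (pi * fst y) (snd y))"
    unfolding W_def
  proof (rule continuous_on_word_eval)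
    show "continuous_on ({0..1} \<times> S2) (\<lambda>y. rot_gens a b c (pi * fst y) (snd y) x)" for x
      by (cases x) (auto simp: rot_gens_def intro!: rot_c continuous_intros)
  qed (auto simp: qnorm_rot_gens)
  have Fc: "continuous_on ({0..1} \<times> S2) (\<lambda>y. F (pi * fst y) (snd y))"
    unfolding F_def
  proof (rule continuous_on_sgn)
    show "continuous_on ({0..1} \<times> S2) (\<lambda>y. quat_imag (W (pi * fst y) (snd y)))"
      unfolding quat_imag_def by (intro continuous_intros Wc)
  qed (auto simp: nz)
  have FS: "F \<theta> v \<in> S2" if "v \<in> S2" for \<theta> v
    using nz[OF that] by (simp add: F_def S2_def norm_sgn)
  have hom: "homotopic_with_canon (\<lambda>_. True) S2 S2 (F 0) (F pi)"
    unfolding homotopic_with_def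
  proof (intro exI[of _ "\<lambda>y. F (pi * fst y) (snd y)"] conjI allI ballI)
    show "continuous_map (prod_topology (top_of_set {0..1}) (top_of_set S2)) (top_of_set S2) (\<lambda>y. F (pi * fst y) (snd y))"
      using Fc FS by (auto simp flip: subtopology_Times simp: image_subset_iff)
  qed simp_all
  have axial: "axial (F \<theta>)" if fixd: "\<And>d. cmod d = 1 \<Longrightarrow> phase d (rot b (cos \<theta>, of_real (sin \<theta>))) = rot b (cos \<theta>, of_real (sin \<theta>))" for \<theta>
    unfolding axial_def
  proof (intro allI impI)
    fix s z d assume v: "(s, z) \<in> S2" and d: "cmod d = 1"
    interpret phase: group_hom S3 S3 "phase d" by (rule group_hom_phase[OF d])
    have "phase d (rot_gens a b c \<theta> (s, z) x) = rot_gens a b c \<theta> (s, d * z) x" for x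
      by (cases x) (simp_all add: rot_gens_def fixd[OF d], simp_all add: phase_def rot_def)
    then have "W \<theta> (s, d * z) = phase d (W \<theta> (s, z))"
      using phase.hom_word_eval[OF gU[OF v], of \<theta> u] by (simp add: W_def o_def)
    then show "F \<theta> (s, d * z) = (fst (F \<theta> (s, z)), d * snd (F \<theta> (s, z)))"
      unfolding F_def by (simp add: sgn_quat_imag_phase[OF d])
  qed
  have axial0: "axial (F 0)" and axialpi: "axial (F pi)"
    by (rule axial, simp add: rot_poles phase_def)+
  have pole: "F \<theta> (\<zeta>, 0) = (sgn (f \<eta> \<zeta>), 0)"
    if "\<theta> = 0 \<and> \<eta> = 1 \<or> \<theta> = pi \<and> \<eta> = -1" "\<zeta> = 1 \<or> \<zeta> = -1" for \<theta> \<eta> \<zeta> :: real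
  proof -
    define t where "t x = (case x of Gen_x \<Rightarrow> a | Gen_y \<Rightarrow> \<eta> * b | Gen_z \<Rightarrow> \<zeta> * c)" for x
    have "rot_gens a b c \<theta> (\<zeta>, 0) = (\<lambda>x. (cis (t x), 0))"
    proof
      show "rot_gens a b c \<theta> (\<zeta>, 0) x = (cis (t x), 0)" for x
        using that by (cases x) (auto simp: rot_gens_def t_def rot_poles)
    qed
    then have "quat_imag (W \<theta> (\<zeta>, 0)) = (sin (exponent_sum Gen_x u * t Gen_x + exponent_sum Gen_y u * t Gen_y +
        exponent_sum Gen_z u * t Gen_z), 0)"
      by (simp only: W_def word_eval_cis quat_imag_def fst_conv snd_conv cis.simps)
    also have "\<dots> = (f \<eta> \<zeta>, 0)" by (simp add: f_def t_def algebra_simps)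
    finally have "quat_imag (W \<theta> (\<zeta>, 0)) = (f \<eta> \<zeta>, 0)" .
    then show ?thesis unfolding F_def by (simp add: sgn_prod_def norm_prod_def sgn_real_def divide_simps abs_if)
  qed
  have vals: "F 0 (1, 0) = (sgn (f 1 1), 0)" "F 0 (-1, 0) = (sgn (f 1 (-1)), 0)"
    "F pi (1, 0) = (sgn (f (-1) 1), 0)" "F pi (-1, 0) = (sgn (f (-1) (-1)), 0)"
    by (simp_all add: pole)
  show False
  proof (cases "\<delta> > 0")
    case True
    then have "f 1 1 < 0" "f 1 (-1) > 0" "f (-1) 1 > 0" "f (-1) (-1) < 0"
      using \<delta> by (auto simp: mult_less_0_iff zero_less_mult_iff)
    then show False
      by (intro axial_swap_fix_not_homotopic[OF axial0 _ _ axialpi _ _ hom]) (simp_all add: vals)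
  next
    case False
    then have "f 1 1 > 0" "f 1 (-1) < 0" "f (-1) 1 < 0" "f (-1) (-1) > 0"
      using \<delta> by (auto simp: mult_less_0_iff zero_less_mult_iff)
    then show False
      by (intro axial_swap_fix_not_homotopic[OF axialpi _ _ axial0 _ _ homotopic_with_symD[OF hom]]) (simp_all add: vals)
  qed
qed

section \<open>Choice of the angles\<close>

text \<open>As \<open>a\<close> is invertible modulo \<open>p\<close>, the multiple \<open>a t\<close> can be made any multiple of \<open>\<pi> / p\<close>
  modulo \<open>\<pi>\<close>. The one chosen is the first that is not below \<open>\<pi> / 2\<close>. It is largest for
  \<open>p = 3\<close>.\<close>

lemma prime_angle:
  fixes p :: nat and a :: int
  assumes p: "prime p" and a: "\<not> int p dvd a"
  shows "\<exists>(t::real) (A::real) (n::int). sin (real p * t) = 0 \<and> sin t \<noteq> 0 \<and> a * t = A + of_int n * pi \<and>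
    pi / 2 \<le> A \<and> A \<le> 2 * pi / 3 \<and> (p \<noteq> 3 \<longrightarrow> A < 2 * pi / 3)"
proof -
  \<comment> \<open>for \<open>p = 2\<close> this gives the angle \<open>\<pi> / 2\<close>, for odd \<open>p\<close> the angle \<open>\<pi> (p + 1) / (2 p)\<close>\<close>
  define h where "h = (p + 1) div 2"
  have "coprime a (int p)" using a p by (metis coprime_commute prime_imp_coprime prime_nat_int_transfer)
  then obtain k' where "[a * k' = 1] (mod int p)" using cong_solve_coprime_int by blast
  then have "[a * k' * int h = 1 * int h] (mod int p)" by (rule cong_scalar_right)
  then have "[int h = a * (k' * int h)] (mod int p)" by (simp add: cong_sym_eq mult.assoc)
  then obtain n where "a * (k' * int h) = int h + int p * n" using cong_iff_lin by blast
  then obtain k where k: "a * k = int h + int p * n" by blast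
  have p0: "real p > 0" using p prime_gt_0_nat by simp
  define t where "t = pi * k / p"
  define A where "A = pi * h / p"
  have "real_of_int a * k = real h + real p * n"
    using k by (metis of_int_add of_int_mult of_int_of_nat_eq)
  then have "a * t = A + of_int n * pi"
    using p0 by (simp add: t_def A_def field_simps)
  moreover have "sin (real p * t) = 0"
    using p0 by (simp add: t_def sin_zero_iff_int2)
  moreover have bounds: "pi / 2 \<le> A \<and> A \<le> 2 * pi / 3 \<and> (p \<noteq> 3 \<longrightarrow> A < 2 * pi / 3)"
  proof -
    have p2: "p \<ge> 2" using p by (rule prime_ge_2_nat)
    have "2 * h \<ge> p" by (simp add: h_def)
    moreover have "3 * h \<le> 2 * p \<and> (p \<noteq> 3 \<longrightarrow> 3 * h < 2 * p)"
      using p2 by (cases "p = 4") (use p in \<open>auto simp: h_def\<close>, presburger+)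
    ultimately have "real p \<le> 2 * real h" "3 * real h \<le> 2 * real p" "p \<noteq> 3 \<longrightarrow> 3 * real h < 2 * real p" by linarith+
    then show ?thesis using p0 by (auto simp: A_def field_simps)
  qed
  moreover have "sin t \<noteq> 0"
  proof
    assume "sin t = 0"
    then obtain j :: int where "t = of_int j * pi" unfolding sin_zero_iff_int2 by blast
    then have "A = of_int (a * j - n) * pi" using \<open>a * t = A + of_int n * pi\<close> by (simp add: algebra_simps)
    then have "sin A = 0" by (simp only: sin_zero_iff_int2) blast
    moreover have "sin A > 0" using bounds pi_gt_zero by (intro sin_gt_zero) linarith+
    ultimately show False by simp
  qed
  ultimately show ?thesis by blast
qed

lemma sin_shift_pi: "sin (x + of_int n * pi) = cos (of_int n * pi) * sin x"
proof -
  have "sin (of_int n * pi) = 0" using sin_zero_iff_int2 by blast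
  then show ?thesis by (simp add: sin_add)
qed

text \<open>With angles \<open>A, B, C\<close> between \<open>\<pi> / 2\<close> and \<open>2 \<pi> / 3\<close>, not all equal to \<open>2 \<pi> / 3\<close>
  since the primes are distinct, the sum \<open>A + B + C\<close> lies strictly between \<open>\<pi>\<close> and \<open>2 \<pi>\<close>, the
  combinations \<open>A + B - C\<close> and \<open>A - B + C\<close> between \<open>0\<close> and \<open>\<pi>\<close>, and \<open>A - B - C\<close> between
  \<open>- \<pi>\<close> and \<open>0\<close>. These are the four signs required by \<open>quaternion_solution\<close>. The shifts by
  multiples of \<open>\<pi>\<close> change all four sines by one common sign \<open>\<delta>\<close>.\<close>

lemma finitely_annihilated_K_class:
  assumes pr: "prime p" "prime q" "prime r" and ne: "p \<noteq> q" "p \<noteq> r" "q \<noteq> r"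
  shows "finitely_annihilated_element (group_K p q r) (K_class p q r u)"
proof (cases "\<exists>x. int (gen_order p q r x) dvd exponent_sum x u")
  case True
  then obtain x where x: "int (gen_order p q r x) dvd exponent_sum x u" by blast
  have "gen_order p q r x > 1" using pr by (cases x) (auto simp: prime_gt_Suc_0_nat)
  then show ?thesis using x by (rule finitely_annihilated_exponent_sum)
next
  case False
  then have nd: "\<not> int p dvd exponent_sum Gen_x u" "\<not> int q dvd exponent_sum Gen_y u" "\<not> int r dvd exponent_sum Gen_z u"
    by (metis gen_order.simps)+
  obtain a A :: real and k :: int where a: "sin (real p * a) = 0" "sin a \<noteq> 0" "exponent_sum Gen_x u * a = A + of_int k * pi"
    and A: "pi / 2 \<le> A" "A \<le> 2 * pi / 3" "p \<noteq> 3 \<longrightarrow> A < 2 * pi / 3" using prime_angle[OF pr(1) nd(1)] by blast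
  obtain b B :: real and l :: int where b: "sin (real q * b) = 0" "sin b \<noteq> 0" "exponent_sum Gen_y u * b = B + of_int l * pi"
    and B: "pi / 2 \<le> B" "B \<le> 2 * pi / 3" "q \<noteq> 3 \<longrightarrow> B < 2 * pi / 3" using prime_angle[OF pr(2) nd(2)] by blast
  obtain c C :: real and m :: int where c: "sin (real r * c) = 0" "sin c \<noteq> 0" "exponent_sum Gen_z u * c = C + of_int m * pi"
    and C: "pi / 2 \<le> C" "C \<le> 2 * pi / 3" "r \<noteq> 3 \<longrightarrow> C < 2 * pi / 3" using prime_angle[OF pr(3) nd(3)] by blast
  have sum: "A + B + C < 2 * pi" using A B C ne by (cases "p = 3"; cases "q = 3") auto
  define \<delta> where "\<delta> = cos (of_int (k + l + m) * pi)"
  have even_shift: "cos (of_int (i + 2 * j) * pi) = cos (of_int i * pi)" for i j :: int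
  proof -
    have "of_int (i + 2 * j) * pi = of_int i * pi + 2 * of_int j * pi" by (simp add: algebra_simps)
    moreover have "sin (2 * of_int j * pi) = 0" "cos (2 * of_int j * pi) = 1"
      using cos_int_2pin[of j] sin_int_2pin[of j] by (simp_all add: mult.commute mult.left_commute)
    ultimately show ?thesis by (simp add: cos_add)
  qed
  have \<delta>2: "\<delta> * (\<delta> * x) = x" for x
  proof -
    have "sin (of_int (k + l + m) * pi) = 0" using sin_zero_iff_int2 by blast
    then have "\<delta>\<^sup>2 = 1" unfolding \<delta>_def using sin_cos_squared_add[of "of_int (k + l + m) * pi"] by simp
    then show ?thesis by (simp add: power2_eq_square flip: mult.assoc)
  qed
  have f: "sin (exponent_sum Gen_x u * a + \<eta> * (exponent_sum Gen_y u * b) + \<zeta> * (exponent_sum Gen_z u * c)) =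
      \<delta> * sin (A + \<eta> * B + \<zeta> * C)" if pm: "\<eta> = 1 \<or> \<eta> = -1" "\<zeta> = 1 \<or> \<zeta> = -1" for \<eta> \<zeta> :: real
  proof -
    obtain i j :: int where ij: "\<eta> * l = of_int (l + 2 * i)" "\<zeta> * m = of_int (m + 2 * j)"
    proof
      show "\<eta> * l = of_int (l + 2 * (if \<eta> = 1 then 0 else - l))" "\<zeta> * m = of_int (m + 2 * (if \<zeta> = 1 then 0 else - m))"
        using pm by auto
    qed
    have "exponent_sum Gen_x u * a + \<eta> * (exponent_sum Gen_y u * b) + \<zeta> * (exponent_sum Gen_z u * c) =
        (A + \<eta> * B + \<zeta> * C) + (of_int k + \<eta> * l + \<zeta> * m) * pi"
      unfolding a(3) b(3) c(3) by (simp add: algebra_simps)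
    also have "of_int k + \<eta> * l + \<zeta> * m = of_int ((k + l + m) + 2 * (i + j))" unfolding ij by simp
    finally show ?thesis unfolding \<delta>_def by (simp only: sin_shift_pi even_shift)
  qed
  have neg: "sin x < 0" if "- pi < x" "x < 0" for x
    using sin_gt_zero[of "- x"] that by simp
  have neg': "sin x < 0" if "pi < x" "x < 2 * pi" for x
    using that by (rule sin_lt_zero)
  have signs: "sin (A + B + C) < 0" "sin (A + B - C) > 0" "sin (A - B + C) > 0" "sin (A - B - C) < 0"
    using A(1,2) B(1,2) C(1,2) sum pi_gt_zero
    by (intro neg neg' sin_gt_zero; linarith)+
  have "\<exists>\<theta>. \<exists>v\<in>S2. word_eval S3 (rot_gens a b c \<theta> v) u \<in> {(1, 0), (-1, 0)}"
    by (rule quaternion_solution[where \<delta> = \<delta>]; subst f; simp add: \<delta>2 signs)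
  then obtain \<theta> v where v: "v \<in> S2" and W: "word_eval S3 (rot_gens a b c \<theta> v) u \<in> {(1, 0), (-1, 0)}" by blast
  have N: "(1, 0) \<in> S2" by (simp add: in_S2)
  show ?thesis
  proof (rule finitely_annihilated_of_quaternions[OF qnorm_rot_gens[OF v] _ W])
    show "rot_gens a b c \<theta> v x [^]\<^bsub>S3\<^esub> gen_order p q r x \<in> {(1, 0), (-1, 0)}" for x
      using rot_sign a(1) b(1) c(1)
      by (cases x) (simp_all only: rot_gens_def xyz.case gen_order.simps pow_rot[OF N] pow_rot[OF v] pow_rot[OF cos_sin_S2])
    show "rot_gens a b c \<theta> v Gen_x \<notin> {(1, 0), (-1, 0)}"
      using rot_not_sign[OF N a(2)] by (simp only: rot_gens_def xyz.case not_False_eq_True)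
  qed
qed

theorem proposition5p14:
  fixes p q r :: nat
  assumes "prime p" "prime q" "prime r"
    and "p \<noteq> q" "p \<noteq> r" "q \<noteq> r"
  shows "group_K p q r \<cong> free_product {0..<3} (\<lambda>i. integer_mod_group ([p, q, r] ! i)) \<and>
    finitely_annihilated (group_K p q r) \<and>
    abelianisation (group_K p q r) \<cong> integer_mod_group (p * q * r) \<and>
    cyclic_group (abelianisation (group_K p q r))"
proof (intro conjI)
  note gt1 = assms(1-3)[THEN prime_gt_1_nat]
  show "group_K p q r \<cong> free_product {0..<3} (\<lambda>i. integer_mod_group ([p, q, r] ! i))"
    by (rule group_K_iso_free_product[OF gt1])
  show "finitely_annihilated (group_K p q r)"
    unfolding finitely_annihilated_def
  proof (intro conjI ballI impI)
    have ann: "finitely_annihilated_element (group_K p q r) g" if "g \<in> carrier (group_K p q r)" for g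
      using that finitely_annihilated_K_class[OF assms] by (auto simp: carrier_group_K)
    show "finitely_annihilated_element (group_K p q r) g" if "g \<in> carrier (group_K p q r)" for g
      using ann[OF that] .
    \<comment> \<open>the identity element is annihilated as well, and this already requires a nontrivial image\<close>
    show "carrier (group_K p q r) \<noteq> {\<one>\<^bsub>group_K p q r\<^esub>}"
    proof
      interpret K: group "group_K p q r" by (rule group_group_K)
      assume triv: "carrier (group_K p q r) = {\<one>\<^bsub>group_K p q r\<^esub>}"
      obtain H :: "nat monoid" and \<phi> where "group H" "\<phi> \<in> hom (group_K p q r) H"
        "\<phi> \<one>\<^bsub>group_K p q r\<^esub> = \<one>\<^bsub>H\<^esub>" "\<phi> ` carrier (group_K p q r) \<noteq> {\<one>\<^bsub>H\<^esub>}"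
        using ann[OF K.one_closed] unfolding finitely_annihilated_element_def by blast
      then show False using triv by simp
    qed
  qed
  show iso: "abelianisation (group_K p q r) \<cong> integer_mod_group (p * q * r)"
    using assms gt1 by (intro abelianisation_group_K) (simp_all add: primes_coprime)
  have "group (abelianisation (group_K p q r))"
    unfolding abelianisation_def
    by (rule normal.factorgroup_is_group[OF group.derived_self_is_normal[OF group_group_K]])
  then show "cyclic_group (abelianisation (group_K p q r))"
    by (rule cyclic_group_iso[OF iso _ group_integer_mod_group cyclic_integer_mod_group])
qed

end
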